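(* Let $M>0$ and let an $m_1\times m_2$ matrix function $v(x,t)$ on $\mathcal{D}=\{(x,t):0\le x<\infty,\ 0\le t<a\}$ be continuously differentiable together with its first derivatives, and let $v_{xx}$ exist. Assume that $v$ satisfies the focusing nonlinear Schr\"odinger equation $$2v_t+\mathrm{i}(v_{xx}+2vv^*v)=0$$ as well as the inequalities $$\sup_{(x,t)\in\mathcal{D}}\|v(x,t)\|\le M,\qquad \sup_{x\in\mathbb{R}_+}\|v_x(x,t)\|<\infty\quad\text{for each }0\le t<a.$$ Then the evolution $\varphi(t,z)$ of the Weyl functions of the Dirac systems $y_x(x,t,z)=G(x,t,z)y(x,t,z)$ (in $x\in[0,\infty)$, for each fixed $t\in[0,a)$) is given, for $\Im z>M$, by $$\varphi(t,z)=\big(R_{21}(t,z)+R_{22}(t,z)\varphi(0,z)\big)\big(R_{11}(t,z)+R_{12}(t,z)\varphi(0,z)\big)^{-1}.$$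
   Context: Let $m_1,m_2$ be positive integers, $m=m_1+m_2$, $$j=\begin{bmatrix} I_{m_1}&0\\ 0&-I_{m_2}\end{bmatrix},\qquad V(x,t)=\begin{bmatrix}0&v(x,t)\\ v(x,t)^*&0\end{bmatrix},$$ $$G(x,t,z)=\mathrm{i}zj+jV,\qquad F(x,t,z)=\mathrm{i}\big(z^2j-\mathrm{i}zjV-(V_x+jV^2)/2\big).$$ $R(x,t,z)$ is the $m\times m$ solution of $R_t=F R$, $R(x,0,z)=I_m$; $R(t,z):=R(0,t,z)$, partitioned into blocks $R(t,z)=\{R_{ik}(t,z)\}_{i,k=1}^2$ with $R_{11}$ of size $m_1\times m_1$. $\|\cdot\|$ is the operator norm induced by $\ell^2$-norms; $\mathbb{C}_M=\{z:\Im z>M\}$. Weyl functions: for fixed $t$, let $u(x,t,z)$ be the solution of $u_x=Gu$, $u(0,t,z)=I_m$. Let $\mathbf{P}_{\ge}(j,\mathbb{C}_M)$ be the class of $m\times m_1$ matrix functions $\mathcal{P}$, meromorphic in $\mathbb{C}_M$, with $\mathcal{P}(z)^*\mathcal{P}(z)>0$, $\mathcal{P}(z)^*j\mathcal{P}(z)\ge0$ in $\mathbb{C}_M$ (excluding possibly a discrete set). $\mathcal{N}(x,t,z)$ is the set of values at $(x,t,z)$ of the functions (removable singularities in $z$ removed) $$\begin{bmatrix}0&I_{m_2}\end{bmatrix}u(x,t,z)^{-1}\mathcal{P}(z)\Big(\begin{bmatrix}I_{m_1}&0\end{bmatrix}u(x,t,z)^{-1}\mathcal{P}(z)\Big)^{-1},\qquad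 \mathcal{P}\in\mathbf{P}_{\ge}(j,\mathbb{C}_M).$$ Since $\|v\|\le M$, for each $t$ there is a unique $m_2\times m_1$ matrix function $\varphi(t,\cdot)$ on $\mathbb{C}_M$ with $\{\varphi(t,z)\}=\bigcap_{x<\infty}\mathcal{N}(x,t,z)$; it is the Weyl function of the system $y_x=Gy$ at $t$. *)

theory Defs
  imports "HOL-Complex_Analysis.Complex_Analysis"
begin

unbundle no fps_syntax

section \<open>Matrices\<close>

text \<open>
  An \<open>r \<times> c\<close> matrix is \<^typ>\<open>complex^'c^'r\<close>. The index type \<^typ>\<open>'m1 + 'm2\<close> realises
  \<open>m = m1 + m2\<close>.
\<close>

definition ctranspose :: "complex^'c^'r \<Rightarrow> complex^'r^'c"
  where "ctranspose A = map_matrix cnj (transpose A)"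

definition cscale :: "complex \<Rightarrow> complex^'c^'r \<Rightarrow> complex^'c^'r"  (infixr \<open>\<cdot>\<close> 75)
  where "c \<cdot> A = map_matrix ((*) c) A"

text \<open>The norm of \<^typ>\<open>complex^'n\<close> is the Euclidean one, so this is the spectral norm.\<close>

definition opnorm :: "complex^'c^'r \<Rightarrow> real"
  where "opnorm A = onorm ((*v) A)"

text \<open>
  The library's inner product on \<^typ>\<open>complex^'n\<close> is the real part of the Hermitian one, hence
  \<open>x \<bullet> (A *v x) = Re (x\<^sup>* A x)\<close>, which is \<open>x\<^sup>* A x\<close> itself for Hermitian \<open>A\<close>.
\<close>

definition pos_semidef :: "complex^'n^'n \<Rightarrow> bool"
  where "pos_semidef A \<longleftrightarrow> ctranspose A = A \<and> (\<forall>x. 0 \<le> x \<bullet> (A *v x))"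

definition pos_def :: "complex^'n^'n \<Rightarrow> bool"
  where "pos_def A \<longleftrightarrow> ctranspose A = A \<and> (\<forall>x. x \<noteq> 0 \<longrightarrow> 0 < x \<bullet> (A *v x))"

definition block_matrix ::
  "complex^'c1^'r1 \<Rightarrow> complex^'c2^'r1 \<Rightarrow> complex^'c1^'r2 \<Rightarrow> complex^'c2^'r2
    \<Rightarrow> complex^('c1 + 'c2)^('r1 + 'r2)"
  where "block_matrix A B C D = (\<chi> i k.
    (case i of
       Inl p \<Rightarrow> (case k of Inl q \<Rightarrow> A $ p $ q | Inr q \<Rightarrow> B $ p $ q)
     | Inr p \<Rightarrow> (case k of Inl q \<Rightarrow> C $ p $ q | Inr q \<Rightarrow> D $ p $ q)))"

definition block11 ::
    "complex^('c1::finite + 'c2::finite)^('r1::finite + 'r2::finite) \<Rightarrow> complex^'c1^'r1"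
  where "block11 A = (\<chi> i k. A $ Inl i $ Inl k)"

definition block12 ::
    "complex^('c1::finite + 'c2::finite)^('r1::finite + 'r2::finite) \<Rightarrow> complex^'c2^'r1"
  where "block12 A = (\<chi> i k. A $ Inl i $ Inr k)"

definition block21 ::
    "complex^('c1::finite + 'c2::finite)^('r1::finite + 'r2::finite) \<Rightarrow> complex^'c1^'r2"
  where "block21 A = (\<chi> i k. A $ Inr i $ Inl k)"

definition block22 ::
    "complex^('c1::finite + 'c2::finite)^('r1::finite + 'r2::finite) \<Rightarrow> complex^'c2^'r2"
  where "block22 A = (\<chi> i k. A $ Inr i $ Inr k)"

text \<open>\<open>[I 0]\<close> and \<open>[0 I]\<close>\<close>

definition row_I0 :: "complex^('m1::finite + 'm2::finite)^'m1"
  where "row_I0 = (\<chi> i k. if k = Inl i then 1 else 0)"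

definition row_0I :: "complex^('m1::finite + 'm2::finite)^'m2"
  where "row_0I = (\<chi> i k. if k = Inr i then 1 else 0)"

section \<open>Differentiation on the semi-strip\<close>

text \<open>
  The height \<open>a\<close> is an extended real, so that \<open>a = \<infinity>\<close> is covered. Derivatives are one-sided on the
  boundary lines \<open>x = 0\<close> and \<open>t = 0\<close>.
\<close>

definition time_interval :: "ereal \<Rightarrow> real set"
  where "time_interval a = {t. 0 \<le> t \<and> ereal t < a}"

definition semistrip :: "ereal \<Rightarrow> (real \<times> real) set"
  where "semistrip a = {0..} \<times> time_interval a"

definition Dx :: "(real \<Rightarrow> real \<Rightarrow> 'a::real_normed_vector) \<Rightarrow> real \<Rightarrow> real \<Rightarrow> 'a"
  where "Dx f x t = vector_derivative (\<lambda>\<xi>. f \<xi> t) (at x within {0..})"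

definition Dt :: "ereal \<Rightarrow> (real \<Rightarrow> real \<Rightarrow> 'a::real_normed_vector) \<Rightarrow> real \<Rightarrow> real \<Rightarrow> 'a"
  where "Dt a f x t = vector_derivative (\<lambda>\<tau>. f x \<tau>) (at t within time_interval a)"

definition x_differentiable :: "ereal \<Rightarrow> (real \<Rightarrow> real \<Rightarrow> 'a::real_normed_vector) \<Rightarrow> bool"
  where "x_differentiable a f \<longleftrightarrow>
    (\<forall>(x, t) \<in> semistrip a. (\<lambda>\<xi>. f \<xi> t) differentiable (at x within {0..}))"

definition t_differentiable :: "ereal \<Rightarrow> (real \<Rightarrow> real \<Rightarrow> 'a::real_normed_vector) \<Rightarrow> bool"
  where "t_differentiable a f \<longleftrightarrow>
    (\<forall>(x, t) \<in> semistrip a. (\<lambda>\<tau>. f x \<tau>) differentiable (at t within time_interval a))"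

definition continuously_differentiable ::
    "ereal \<Rightarrow> (real \<Rightarrow> real \<Rightarrow> 'a::real_normed_vector) \<Rightarrow> bool"
  where "continuously_differentiable a f \<longleftrightarrow>
    x_differentiable a f \<and> t_differentiable a f \<and>
    continuous_on (semistrip a) (\<lambda>(x, t). f x t) \<and>
    continuous_on (semistrip a) (\<lambda>(x, t). Dx f x t) \<and>
    continuous_on (semistrip a) (\<lambda>(x, t). Dt a f x t)"

section \<open>Dirac system and focusing NLS\<close>

definition j_mat :: "complex^('m1::finite + 'm2::finite)^('m1 + 'm2)"
  where "j_mat = block_matrix (mat 1) 0 0 (- mat 1)"

definition V_mat ::
    "(real \<Rightarrow> real \<Rightarrow> complex^'m2^'m1) \<Rightarrow> real \<Rightarrow> real \<Rightarrow> complex^('m1 + 'm2)^('m1 + 'm2)"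
  where "V_mat v x t = block_matrix 0 (v x t) (ctranspose (v x t)) 0"

definition G_mat ::
    "(real \<Rightarrow> real \<Rightarrow> complex^'m2^'m1) \<Rightarrow> real \<Rightarrow> real \<Rightarrow> complex
      \<Rightarrow> complex^('m1 + 'm2)^('m1 + 'm2)"
  where "G_mat v x t z = (\<i> * z) \<cdot> j_mat + j_mat ** V_mat v x t"

definition F_mat ::
    "(real \<Rightarrow> real \<Rightarrow> complex^'m2^'m1) \<Rightarrow> real \<Rightarrow> real \<Rightarrow> complex
      \<Rightarrow> complex^('m1 + 'm2)^('m1 + 'm2)"
  where "F_mat v x t z =
    \<i> \<cdot> (z\<^sup>2 \<cdot> j_mat - (\<i> * z) \<cdot> (j_mat ** V_mat v x t)
         - (1 / 2) \<cdot> (Dx (V_mat v) x t + j_mat ** (V_mat v x t ** V_mat v x t)))"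

definition focusing_NLS :: "ereal \<Rightarrow> (real \<Rightarrow> real \<Rightarrow> complex^'m2^'m1) \<Rightarrow> bool"
  where "focusing_NLS a v \<longleftrightarrow> (\<forall>(x, t) \<in> semistrip a.
    2 \<cdot> Dt a v x t
      + \<i> \<cdot> (Dx (Dx v) x t + 2 \<cdot> (v x t ** ctranspose (v x t) ** v x t)) = 0)"

section \<open>Weyl functions\<close>

definition half_plane :: "real \<Rightarrow> complex set"
  where "half_plane M = {z. M < Im z}"

text \<open>
  In the library's notion of meromorphy the values at an isolated set of points (in particular at
  the poles) are irrelevant. The exceptional discrete set has no accumulation point in the
  half-plane.
\<close>

definition P_class :: "real \<Rightarrow> (complex \<Rightarrow> complex^'m1^('m1 + 'm2::finite)) set"
  where "P_class M = {P.
    (\<forall>i k. (\<lambda>z. P z $ i $ k) meromorphic_on half_plane M) \<and>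
    (\<forall>\<^sub>\<approx>z \<in> half_plane M.
      pos_def (ctranspose (P z) ** P z) \<and> pos_semidef (ctranspose (P z) ** j_mat ** P z))}"

text \<open>Below, \<open>U\<close> stands for \<open>z \<mapsto> u(x,t,z)\<close> with \<open>x\<close> and \<open>t\<close> fixed.\<close>

definition weyl_quotient ::
    "(complex \<Rightarrow> complex^('m1 + 'm2)^('m1 + 'm2)) \<Rightarrow> (complex \<Rightarrow> complex^'m1^('m1 + 'm2))
      \<Rightarrow> complex \<Rightarrow> complex^'m1^'m2"
  where "weyl_quotient U P z =
    (row_0I ** matrix_inv (U z) ** P z) ** matrix_inv (row_I0 ** matrix_inv (U z) ** P z)"

definition weyl_set ::
    "real \<Rightarrow> (complex \<Rightarrow> complex^('m1 + 'm2)^('m1 + 'm2)) \<Rightarrow> complex \<Rightarrow> (complex^'m1^'m2) set"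
  where "weyl_set M U z =
    (\<lambda>P. \<chi> i k. remove_sings (\<lambda>\<zeta>. weyl_quotient U P \<zeta> $ i $ k) z) ` P_class M"

definition is_weyl_function ::
    "real \<Rightarrow> (real \<Rightarrow> complex \<Rightarrow> complex^('m1 + 'm2)^('m1 + 'm2))
      \<Rightarrow> (complex \<Rightarrow> complex^'m1^'m2) \<Rightarrow> bool"
  where "is_weyl_function M u \<phi> \<longleftrightarrow>
    (\<forall>z \<in> half_plane M. {\<phi> z} = (\<Inter>x \<in> {0..}. weyl_set M (u x) z))"

end

theory Submission
  imports Defs
begin

text \<open>
  Write \<open>[w] = w\<^sup>* j w\<close>. Along solutions of \<open>y\<^sub>x = G y\<close> with \<open>Im z > M\<close> the form \<open>[y]\<close> decreases
  at rate at least \<open>2 (Im z - M) |y|\<^sup>2\<close>. Hence the matrices \<open>\<phi>\<close> with \<open>[u(x,t,z) [I; \<phi>] c] \<ge> 0\<close>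
  for all \<open>c\<close> form, as \<open>x\<close> grows, a nested family of nonempty compact sets. Each of them lies in
  the corresponding Weyl set (take for \<open>P\<close> the constant \<open>u(x,t,z) [I; \<phi>]\<close>), so by uniqueness the
  Weyl function is the one point of their intersection.

  The zero curvature equation gives \<open>u\<^sub>t = F u - u F(0,t,z)\<close>, so \<open>u(x,t,z) R(0,t,z)\<close> solves \<open>Y\<^sub>t
  = F Y\<close>. In \<open>F + F\<^sup>*\<close> the derivative \<open>v\<^sub>x\<close> cancels, so \<open>|Y(x,t) w| \<le> C |Y(x,0) w|\<close> with \<open>C\<close>
  independent of \<open>x\<close>. If \<open>y(x) = u(x,0,z) [I; \<phi>(0,z)] c\<close> and \<open>[Y(x,t) [I; \<phi>(0,z)] c]\<close> were
  negative at some \<open>x\<close>, then \<open>|y|\<close> would stay bounded away from \<open>0\<close>, and \<open>[y]\<close> would become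
  negative. Thus the quotient of the blocks of \<open>R(0,t,z) [I; \<phi>(0,z)]\<close> has the property that
  characterizes \<open>\<phi>(t,z)\<close>.
\<close>

no_notation fps_nth (infixl \<open>$\<close> 75)

section \<open>Block matrices and the indefinite form\<close>

lemma inner_ctranspose: "(A *v x) \<bullet> y = x \<bullet> (ctranspose A *v y)"
  for A :: "complex^'c^'r"
proof -
  have 1: "(a * b) \<bullet> c = b \<bullet> (cnj a * c)" for a b c :: complex
    by (simp add: inner_complex_def algebra_simps)
  have "(A *v x) \<bullet> y = (\<Sum>i\<in>UNIV. \<Sum>k\<in>UNIV. x $ k \<bullet> (cnj (A $ i $ k) * y $ i))"
    by (simp add: inner_vec_def matrix_vector_mult_def inner_sum_left 1)
  also have "\<dots> = x \<bullet> (ctranspose A *v y)"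
    by (subst sum.swap)
       (simp add: inner_vec_def matrix_vector_mult_def ctranspose_def transpose_def map_matrix_def
          inner_sum_right)
  finally show ?thesis .
qed

lemma ctranspose_ctranspose [simp]: "ctranspose (ctranspose A) = A"
  by (simp add: ctranspose_def transpose_def map_matrix_def vec_eq_iff)

lemma ctranspose_nth [simp]: "ctranspose A $ i $ k = cnj (A $ k $ i)"
  by (simp add: ctranspose_def transpose_def map_matrix_def)

lemma cscale_nth [simp]: "(c \<cdot> A) $ i $ k = c * A $ i $ k"
  by (simp add: cscale_def map_matrix_def)

lemma ctranspose_mult: "ctranspose (A ** B) = ctranspose B ** ctranspose A"
  by (simp add: vec_eq_iff matrix_matrix_mult_def mult.commute)

lemma cscale_mult_left [simp]: "(c \<cdot> A) ** B = c \<cdot> (A ** B)"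
  by (simp add: vec_eq_iff matrix_matrix_mult_def sum_distrib_left mult_ac)

lemma cscale_mult_right [simp]: "A ** (c \<cdot> B) = c \<cdot> (A ** B)"
  by (simp add: vec_eq_iff matrix_matrix_mult_def sum_distrib_left mult_ac)

lemma cscale_vector_mult: "(c \<cdot> A) *v x = c *s (A *v x)"
  by (simp add: vec_eq_iff matrix_vector_mult_def sum_distrib_left mult_ac)

lemma norm_vector_smult_complex: "norm (c *s x) = cmod c * norm x" for x :: "complex^'n"
  by (simp add: norm_vec_def norm_mult L2_set_right_distrib)

lemma opnorm_nonneg: "0 \<le> opnorm A"
  unfolding opnorm_def by (rule onorm_pos_le) simp

lemma norm_mult_opnorm: "norm (A *v x) \<le> opnorm A * norm x"
  unfolding opnorm_def by (rule onorm) simp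

text \<open>The Hermitian form of a skew-Hermitian matrix is purely imaginary, and the inner product
  retains only its real part.\<close>

lemma skew_inner_zero:
  assumes "ctranspose A = - A"
  shows "x \<bullet> (A *v x) = 0"
proof -
  have "(A *v x) \<bullet> x = x \<bullet> (- A *v x)"
    by (metis inner_ctranspose assms)
  also have "- A *v x = - (A *v x)" by (simp add: vec_eq_iff matrix_vector_mult_def sum_negf)
  finally show ?thesis by (simp add: inner_commute)
qed

text \<open>With \<open>y = A* x\<close> one has \<open>|y|^2 = x \<bullet> A y\<close>, which is at
  most \<open>M |x| |y|\<close>; then \<open>|y|\<close> is cancelled. The lower block of
  \<open>V\<close> is estimated in this way.\<close>

lemma opnorm_ctranspose_bound:
  assumes "opnorm A \<le> M"
  shows "norm (ctranspose A *v x) \<le> M * norm x"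
proof (cases "ctranspose A *v x = 0")
  case False
  let ?y = "ctranspose A *v x"
  have "norm ?y * norm ?y = ?y \<bullet> ?y"
    by (simp add: power2_norm_eq_inner flip: power2_eq_square)
  also have "\<dots> = x \<bullet> (A *v ?y)" by (simp add: inner_ctranspose[of "ctranspose A"])
  also have "\<dots> \<le> norm x * norm (A *v ?y)" by (rule norm_cauchy_schwarz)
  also have "\<dots> \<le> norm x * (M * norm ?y)"
    by (intro mult_left_mono order.trans[OF norm_mult_opnorm] mult_right_mono assms) auto
  finally show ?thesis using False by (simp add: mult_ac)
next
  case True
  then show ?thesis using assms opnorm_nonneg[of A] by simp
qed

section \<open>Splitting into blocks, and the indefinite form\<close>

lemma UNIV_sum_split: "(\<Sum>i\<in>UNIV. f i) = (\<Sum>p\<in>UNIV. f (Inl p)) + (\<Sum>q\<in>UNIV. f (Inr q))"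
  for f :: "'a::finite + 'b::finite \<Rightarrow> 'c::comm_monoid_add"
  by (simp add: UNIV_Plus_UNIV[symmetric] sum.Plus del: UNIV_Plus_UNIV)

lemma all_sum_iff: "(\<forall>i. P i) \<longleftrightarrow> (\<forall>p. P (Inl p)) \<and> (\<forall>q. P (Inr q))"
  by (metis sum.exhaust)

lemma row_I0_vector [simp]: "(row_I0 *v w) $ p = w $ Inl p"
  by (simp add: row_I0_def matrix_vector_mult_def if_distrib[of "\<lambda>x. x * _"] cong: if_cong)

lemma row_0I_vector [simp]: "(row_0I *v w) $ p = w $ Inr p"
  by (simp add: row_0I_def matrix_vector_mult_def if_distrib[of "\<lambda>x. x * _"] cong: if_cong)

lemma row_I0_matrix [simp]: "(row_I0 ** A) $ p $ k = A $ Inl p $ k"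
  by (simp add: row_I0_def matrix_matrix_mult_def if_distrib[of "\<lambda>x. x * _"] cong: if_cong)

lemma row_0I_matrix [simp]: "(row_0I ** A) $ p $ k = A $ Inr p $ k"
  by (simp add: row_0I_def matrix_matrix_mult_def if_distrib[of "\<lambda>x. x * _"] cong: if_cong)

lemma inner_blocks: "x \<bullet> y = (row_I0 *v x) \<bullet> (row_I0 *v y) + (row_0I *v x) \<bullet> (row_0I *v y)"
  for x y :: "complex^('m1::finite + 'm2::finite)"
  by (simp add: inner_vec_def UNIV_sum_split)

lemma norm_blocks: "(norm w)\<^sup>2 = (norm (row_I0 *v w))\<^sup>2 + (norm (row_0I *v w))\<^sup>2"
  for w :: "complex^('m1::finite + 'm2::finite)"
  unfolding power2_norm_eq_inner by (rule inner_blocks)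

text \<open>This is \<open>[w]\<close>. As \<open>j\<close> is Hermitian, \<open>w* j w\<close> is
  real, so the real inner product loses nothing.\<close>

definition jform :: "complex^('m1::finite + 'm2::finite) \<Rightarrow> real"
  where "jform w = w \<bullet> (j_mat *v w)"

lemma j_mat_nth [simp]:
  "j_mat $ Inl p $ Inl p' = (if p = p' then 1 else 0)" "j_mat $ Inr r $ Inr r' = (if r = r' then
      -1 else 0)"
  "j_mat $ Inl p $ Inr r = 0" "j_mat $ Inr r $ Inl p = 0"
  by (simp_all add: j_mat_def block_matrix_def mat_def)

lemma j_mat_vector_nth [simp]:
  "(j_mat *v w) $ Inl p = w $ Inl p" "(j_mat *v w) $ Inr r = - w $ Inr r"
  by (simp_all add: matrix_vector_mult_def UNIV_sum_split if_distrib[of "\<lambda>x. x * _"] cong: if_cong)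

lemma j_mat_vector:
  "row_I0 *v (j_mat *v w) = row_I0 *v w" "row_0I *v (j_mat *v w) = - (row_0I *v w)"
  by (simp_all add: vec_eq_iff)

lemma jform_blocks: "jform w = (norm (row_I0 *v w))\<^sup>2 - (norm (row_0I *v w))\<^sup>2"
  unfolding jform_def inner_blocks[of w] j_mat_vector power2_norm_eq_inner by simp

lemma jform_le_norm: "jform w \<le> (norm w)\<^sup>2" "- jform w \<le> (norm w)\<^sup>2"
  unfolding jform_blocks norm_blocks by auto

text \<open>The matrix \<open>V\<close> at a point where \<open>v\<close> takes the value
  \<open>q\<close>. Because of the conjugate transpose it is only real-linear in
  \<open>q\<close>.\<close>

definition offdiag :: "complex^'m2^'m1 \<Rightarrow> complex^('m1::finite + 'm2::finite)^('m1 + 'm2)"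
  where "offdiag q = block_matrix 0 q (ctranspose q) 0"

lemma offdiag_nth [simp]:
  "offdiag q $ Inl p $ Inl p' = 0" "offdiag q $ Inr r $ Inr r' = 0"
  "offdiag q $ Inl p $ Inr r = q $ p $ r" "offdiag q $ Inr r $ Inl p = cnj (q $ p $ r)"
  by (simp_all add: offdiag_def block_matrix_def)

lemma offdiag_vector:
  "row_I0 *v (offdiag q *v w) = q *v (row_0I *v w)"
  "row_0I *v (offdiag q *v w) = ctranspose q *v (row_I0 *v w)"
proof -
  have "(offdiag q *v w) $ Inl p = (q *v (row_0I *v w)) $ p"
    "(offdiag q *v w) $ Inr r = (ctranspose q *v (row_I0 *v w)) $ r" for p r
    unfolding matrix_vector_mult_def[of "offdiag q"] matrix_vector_mult_def[of q]
     matrix_vector_mult_def[of "ctranspose q"]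
    by (simp_all add: UNIV_sum_split)
  then show "row_I0 *v (offdiag q *v w) = q *v (row_0I *v w)"
    "row_0I *v (offdiag q *v w) = ctranspose q *v (row_I0 *v w)"
    by (simp_all add: vec_eq_iff)
qed

text \<open>\<open>V\<close> exchanges the two components of \<open>w\<close>, so each is bounded
  separately with the factor \<open>M\<close> and the squares add up.\<close>

lemma norm_offdiag_le:
  assumes "opnorm q \<le> M"
  shows "norm (offdiag q *v w) \<le> M * norm w"
proof -
  have M: "0 \<le> M" using assms opnorm_nonneg[of q] by linarith
  have 1: "norm (q *v y) \<le> M * norm y" for y
    by (intro order.trans[OF norm_mult_opnorm] mult_right_mono assms) auto
  have "(norm (offdiag q *v w))\<^sup>2 \<le> (M * norm (row_0I *v w))\<^sup>2 + (M * norm (row_I0 *v w))\<^sup>2"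
    unfolding norm_blocks[of "offdiag q *v w"] offdiag_vector
    by (intro add_mono power_mono 1 opnorm_ctranspose_bound[OF assms]) auto
  also have "\<dots> = (M * norm w)\<^sup>2"
    unfolding power_mult_distrib norm_blocks[of w] by (simp add: algebra_simps)
  finally show ?thesis by (rule power2_le_imp_le) (simp add: M)
qed

lemma ctranspose_offdiag [simp]: "ctranspose (offdiag q) = offdiag q"
  by (simp add: vec_eq_iff all_sum_iff)

lemma ctranspose_j [simp]: "ctranspose j_mat = j_mat"
  by (simp add: vec_eq_iff all_sum_iff)

lemma j_mat_mult:
  "(j_mat ** A) $ Inl p $ k = A $ Inl p $ k" "(j_mat ** A) $ Inr q $ k = - A $ Inr q $ k"
  by (simp_all add: matrix_matrix_mult_def UNIV_sum_split if_distrib[of "\<lambda>x. x * _"] cong: if_cong)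

lemma mult_j_mat:
  "(A ** j_mat) $ k $ Inl p = A $ k $ Inl p" "(A ** j_mat) $ k $ Inr q = - A $ k $ Inr q"
  by (simp_all add: matrix_matrix_mult_def UNIV_sum_split if_distrib[of "\<lambda>x. _ * x"] cong: if_cong)

lemma j_mat_square: "j_mat ** j_mat = mat 1"
  by (simp add: vec_eq_iff all_sum_iff j_mat_mult) (simp add: mat_def)

text \<open>The anticommutation of \<open>j\<close> and \<open>V\<close> is behind the cancellations
  in the zero curvature equation.\<close>

lemma offdiag_j: "offdiag q ** j_mat = - (j_mat ** offdiag q)"
  by (simp add: vec_eq_iff all_sum_iff j_mat_mult mult_j_mat)

lemma norm_j_mat [simp]: "norm (j_mat *v w) = norm w"
proof -
  have "(norm (j_mat *v w))\<^sup>2 = (norm w)\<^sup>2"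
    unfolding norm_blocks[of "j_mat *v w"] norm_blocks[of w] j_mat_vector by simp
  then show ?thesis by simp
qed

text \<open>The column \<open>[I; \<phi>]\<close>, whose range is the graph of
  \<open>\<phi>\<close>.\<close>

definition stack :: "complex^'m1^'m2 \<Rightarrow> complex^'m1^('m1::finite + 'm2::finite)"
  where "stack \<phi> = (\<chi> i k. case i of Inl p \<Rightarrow> mat 1 $ p $ k | Inr q \<Rightarrow> \<phi> $ q $ k)"

lemma row_stack [simp]: "row_I0 ** stack \<phi> = mat 1" "row_0I ** stack \<phi> = \<phi>"
  by (simp_all add: vec_eq_iff stack_def)

lemma row_stack_vector [simp]: "row_I0 *v (stack \<phi> *v c) = c" "row_0I *v (stack \<phi> *v c) = \<phi> *v c"
  by (simp_all add: matrix_vector_mul_assoc)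

lemma matrix_inv_mult:
  assumes "invertible A"
  shows "A ** matrix_inv A = mat 1" "matrix_inv A ** A = mat 1"
  using someI_ex[OF assms[unfolded invertible_def]] unfolding matrix_inv_def by auto

text \<open>Normalising the upper block to \<open>I\<close> by an invertible right factor shows that
  the range of \<open>W\<close> is the graph of its block quotient.\<close>

lemma stack_decompose:
  fixes W :: "complex^'b^('b::finite + 'c::finite)"
  assumes "invertible (row_I0 ** W)"
  shows "stack (row_0I ** W ** matrix_inv (row_I0 ** W)) ** (row_I0 ** W) = W" (is "?L = W")
proof -
  have inv: "matrix_inv (row_I0 ** W) ** (row_I0 ** W) = mat 1"
    by (rule matrix_inv_mult(2)[OF assms])
  have upper: "row_I0 ** ?L = row_I0 ** W"
    by (simp only: matrix_mul_assoc row_stack matrix_mul_lid)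
  have "row_0I ** ?L = (row_0I ** W) ** (matrix_inv (row_I0 ** W) ** (row_I0 ** W))"
    by (simp only: matrix_mul_assoc row_stack)
  then have lower: "row_0I ** ?L = row_0I ** W"
    by (simp only: inv matrix_mul_rid)
  have "?L $ i $ k = W $ i $ k" for i k
  proof (cases i)
    case (Inl p)
    show ?thesis using arg_cong[OF upper, of "\<lambda>A. A $ p $ k"]
      unfolding row_I0_matrix Inl .
  next
    case (Inr p)
    show ?thesis using arg_cong[OF lower, of "\<lambda>A. A $ p $ k"]
      unfolding row_0I_matrix Inr .
  qed
  then show ?thesis by (simp only: vec_eq_iff) blast
qed

section \<open>Differential inequalities and matrix inversion\<close>

lemma increment_le:
  fixes g :: "real \<Rightarrow> real"
  assumes deriv: "\<And>s. s \<in> {a..b} \<Longrightarrow> (g has_real_derivative g' s) (at s within S)"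
    and sub: "{a..b} \<subseteq> S" and "a \<le> b"
    and le: "\<And>s. s \<in> {a..b} \<Longrightarrow> g' s \<le> k"
  shows "g b \<le> g a + k * (b - a)"
proof -
  have "(g has_derivative (*) (g' s)) (at s within {a..b})" if "a \<le> s" "s \<le> b" for s
    using has_field_derivative_subset[OF deriv sub, of s] that
    by (simp add: has_field_derivative_def)
  from mvt_very_simple[OF \<open>a \<le> b\<close> this] obtain s where "s \<in> {a..b}" "g b - g a = g' s * (b - a)"
    by auto
  then show ?thesis using mult_right_mono[OF le, of s "b - a"] \<open>a \<le> b\<close> by simp
qed

text \<open>The integrating factor \<open>exp (- L * s)\<close> makes the product nonincreasing.
  Neither \<open>L\<close> nor \<open>g\<close> carries a sign condition, so
  \<open>g = - |w|^2\<close> turns the lemma into a lower bound on \<open>|w|^2\<close>.\<close>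

lemma gronwall:
  fixes g :: "real \<Rightarrow> real"
  assumes deriv: "\<And>s. s \<in> {a..b} \<Longrightarrow> (g has_real_derivative g' s) (at s within S)"
    and sub: "{a..b} \<subseteq> S" and "a \<le> b"
    and le: "\<And>s. s \<in> {a..b} \<Longrightarrow> g' s \<le> L * g s"
  shows "g b \<le> g a * exp (L * (b - a))"
proof -
  have "exp (- L * b) * g b \<le> exp (- L * a) * g a + 0 * (b - a)"
  proof (rule increment_le[OF _ sub \<open>a \<le> b\<close>])
    fix s assume s: "s \<in> {a..b}"
    show "((\<lambda>s. exp (- L * s) * g s) has_real_derivative exp (- L * s) * (g' s - L * g s)) (at s
        within S)"
      using deriv[OF s] by (auto intro!: derivative_eq_intros simp: algebra_simps)
    show "exp (- L * s) * (g' s - L * g s) \<le> 0"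
      using le[OF s] by (simp add: mult_nonneg_nonpos)
  qed
  then have "exp (L * b) * (exp (- L * b) * g b) \<le> exp (L * b) * (exp (- L * a) * g a)"
    by (intro mult_left_mono) auto
  then show ?thesis by (simp add: algebra_simps exp_diff exp_minus divide_simps)
qed

lemma has_real_derivative_norm_square:
  fixes w :: "real \<Rightarrow> 'a::real_inner"
  assumes "(w has_vector_derivative w') (at s within S)"
  shows "((\<lambda>s. (norm (w s))\<^sup>2) has_real_derivative 2 * (w s \<bullet> w')) (at s within S)"
proof -
  have "((\<lambda>s. w s \<bullet> w s) has_vector_derivative (w s \<bullet> w' + w' \<bullet> w s)) (at s within S)"
    by (rule bounded_bilinear.has_vector_derivative[OF bounded_bilinear_inner assms assms])
  then show ?thesis
    by (simp add: power2_norm_eq_inner has_real_derivative_iff_has_vector_derivative inner_commute)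
qed

text \<open>Gronwall is applied to \<open>|w|^2 + \<beta>^2\<close>: the norm itself may fail to be
  differentiable at zeros of \<open>w\<close>, and the added constant absorbs the inhomogeneity. The
  bound is linear in \<open>\<beta>\<close>, so a small perturbation has a small effect.\<close>

lemma norm_le_gronwall:
  fixes w :: "real \<Rightarrow> 'a::real_inner"
  assumes deriv: "\<And>s. s \<in> {a..b} \<Longrightarrow> (w has_vector_derivative w' s) (at s within S)"
    and sub: "{a..b} \<subseteq> S" and "a \<le> b" and "0 \<le> \<alpha>" "0 \<le> \<beta>"
    and init: "w a = 0"
    and le: "\<And>s. s \<in> {a..b} \<Longrightarrow> norm (w' s) \<le> \<alpha> * norm (w s) + \<beta>"
  shows "norm (w b) \<le> \<beta> * exp ((\<alpha> + 1) * (b - a))"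
proof -
  let ?L = "2 * (\<alpha> + 1)" and ?g = "\<lambda>s. (norm (w s))\<^sup>2 + \<beta>\<^sup>2"
  have "?g b \<le> ?g a * exp (?L * (b - a))"
  proof (rule gronwall[OF _ sub \<open>a \<le> b\<close>])
    fix s assume s: "s \<in> {a..b}"
    show "(?g has_real_derivative 2 * (w s \<bullet> w' s)) (at s within S)"
      using DERIV_add[OF has_real_derivative_norm_square[OF deriv[OF s]] DERIV_const[of "\<beta>\<^sup>2"]]
          by simp
    have "w s \<bullet> w' s \<le> norm (w s) * norm (w' s)" by (rule norm_cauchy_schwarz)
    also have "\<dots> \<le> norm (w s) * (\<alpha> * norm (w s) + \<beta>)"
      by (intro mult_left_mono le s) auto
    also have "\<dots> = \<alpha> * (norm (w s))\<^sup>2 + norm (w s) * \<beta>" by (simp add: power2_eq_square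
        algebra_simps)
    \<comment> \<open>The mixed term is split by \<open>2 a b \<le> a^2 + b^2\<close>, whence the
      \<open>+ 1\<close> in the rate.\<close>
    also have "norm (w s) * \<beta> \<le> ((norm (w s))\<^sup>2 + \<beta>\<^sup>2) / 2"
      using sum_squares_bound[of "norm (w s)" \<beta>] by simp
    also have "\<alpha> * (norm (w s))\<^sup>2 + ((norm (w s))\<^sup>2 + \<beta>\<^sup>2) / 2 \<le> (\<alpha> + 1) * ?g s"
      using \<open>0 \<le> \<alpha>\<close> by (simp add: algebra_simps)
    finally show "2 * (w s \<bullet> w' s) \<le> ?L * ?g s" by (simp only: mult.assoc
        mult_le_cancel_left_pos zero_less_numeral)
  qed
  then have "(norm (w b))\<^sup>2 \<le> \<beta>\<^sup>2 * exp (?L * (b - a))" using init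
    by (simp add: add.commute) (smt (verit) zero_le_power2)
  also have "\<dots> = (\<beta> * exp ((\<alpha> + 1) * (b - a)))\<^sup>2"
    by (simp add: power_mult_distrib flip: exp_of_nat_mult)
  finally show ?thesis by (rule power2_le_imp_le) (simp add: \<open>0 \<le> \<beta>\<close>)
qed

section \<open>Calculus of matrix products and inverses\<close>

lemma bounded_bilinear_matrix_mult:
  "bounded_bilinear ((**) :: complex^'b^'a \<Rightarrow> complex^'c^'b \<Rightarrow> complex^'c^'a)"
  unfolding bilinear_conv_bounded_bilinear[symmetric] bilinear_def
  by (auto intro!: linearI simp: vec_eq_iff matrix_matrix_mult_def algebra_simps sum.distrib
      scaleR_sum_right)

lemma bounded_bilinear_matrix_vector_mult:
  "bounded_bilinear ((*v) :: complex^'b^'a \<Rightarrow> complex^'b \<Rightarrow> complex^'a)"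
  unfolding bilinear_conv_bounded_bilinear[symmetric] bilinear_def
  by (auto intro!: linearI simp: vec_eq_iff matrix_vector_mult_def algebra_simps sum.distrib
      scaleR_sum_right)

lemma bounded_linear_cscale: "bounded_linear ((\<cdot>) c)"
  unfolding linear_conv_bounded_linear[symmetric]
  by (auto intro!: linearI simp: vec_eq_iff algebra_simps)

lemma bounded_linear_offdiag: "bounded_linear offdiag"
  unfolding linear_conv_bounded_linear[symmetric]
  by (rule linearI) (simp_all add: vec_eq_iff all_sum_iff)

lemma norm_cscale: "norm (c \<cdot> A) = cmod c * norm A"
  unfolding norm_vec_def by (simp add: norm_mult L2_set_right_distrib)

lemma matrix_inv_mult_iff:
  fixes A :: "'a::field^'n^'n"
  assumes "invertible A"
  shows "A *v x = y \<longleftrightarrow> x = matrix_inv A *v y"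
  using matrix_inv_mult[OF assms] by (metis matrix_vector_mul_assoc matrix_vector_mul_lid)

lemma invertible_iff_kernel:
  fixes A :: "'a::field^'n^'n"
  shows "invertible A \<longleftrightarrow> (\<forall>x. A *v x = 0 \<longrightarrow> x = 0)"
  unfolding invertible_left_inverse matrix_left_invertible_injective
  by (metis inj_matrix_vector_mult invertible_left_inverse matrix_left_invertible_ker
      matrix_left_invertible_injective)

lemma tendsto_det:
  fixes X :: "'b \<Rightarrow> complex^'n^'n"
  assumes "\<And>i k. ((\<lambda>s. X s $ i $ k) \<longlongrightarrow> A $ i $ k) F"
  shows "((\<lambda>s. det (X s)) \<longlongrightarrow> det A) F"
  unfolding det_def by (intro tendsto_intros assms)

text \<open>Cramer's rule for a unit vector on the right-hand side. Entries of the inverse become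
  quotients of determinants, from which continuity of inversion can be read off.\<close>

lemma matrix_inv_nth:
  fixes A :: "'a::field^'n^'n"
  assumes "det A \<noteq> 0"
  shows "matrix_inv A $ k $ l = det (\<chi> i j. if j = k then axis l 1 $ i else A $ i $ j) / det A"
proof -
  have "A *v (matrix_inv A *v axis l 1) = axis l 1"
    by (rule matrix_inv_mult_iff[THEN iffD2]) (use assms invertible_det_nz in auto)
  then have "matrix_inv A *v axis l 1 = (\<chi> k. det (\<chi> i j. if j = k then axis l 1 $ i else A $ i
      $ j) / det A)"
    unfolding cramer[OF assms] .
  then have "(matrix_inv A *v axis l 1) $ k = det (\<chi> i j. if j = k then axis l 1 $ i else A $ i
      $ j) / det A"
    by simp
  moreover have "(matrix_inv A *v axis l 1) $ k = matrix_inv A $ k $ l"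
    by (simp add: matrix_vector_mult_def axis_def if_distrib[of "\<lambda>x. _ * x"] cong: if_cong)
  ultimately show ?thesis by simp
qed

text \<open>The matrices \<open>X s\<close> need not all be invertible: as \<open>det A\<close> is
  nonzero, \<open>det (X s)\<close> is eventually nonzero, and then Cramer's formula holds.\<close>

lemma tendsto_matrix_inv:
  fixes X :: "'b \<Rightarrow> complex^'n^'n"
  assumes lim: "(X \<longlongrightarrow> A) F" and inv: "invertible A"
  shows "((\<lambda>s. matrix_inv (X s)) \<longlongrightarrow> matrix_inv A) F"
proof -
  have A: "det A \<noteq> 0" using inv invertible_det_nz by blast
  have entry: "((\<lambda>s. X s $ i $ k) \<longlongrightarrow> A $ i $ k) F" for i k
    by (intro tendsto_intros lim)
  have detlim: "((\<lambda>s. det (X s)) \<longlongrightarrow> det A) F"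
    by (intro tendsto_det entry)
  then have ev: "\<forall>\<^sub>F s in F. det (X s) \<noteq> 0" using A by (rule tendsto_imp_eventually_ne)
  have "((\<lambda>s. matrix_inv (X s) $ k $ l) \<longlongrightarrow> matrix_inv A $ k $ l) F" for k l
  proof (rule Lim_transform_eventually)
    show "((\<lambda>s. det (\<chi> i j. if j = k then axis l 1 $ i else X s $ i $ j) / det (X s))
       \<longlongrightarrow> matrix_inv A $ k $ l) F"
      unfolding matrix_inv_nth[OF A]
      by (intro tendsto_divide detlim A tendsto_det) (auto intro!: entry)
    show "\<forall>\<^sub>F s in F. det (\<chi> i j. if j = k then axis l 1 $ i else X s $ i $ j) / det (X s)
       = matrix_inv (X s) $ k $ l"
      using ev by eventually_elim (simp add: matrix_inv_nth)
  qed
  then have "((\<lambda>s. \<chi> k l. matrix_inv (X s) $ k $ l) \<longlongrightarrow> (\<chi> k l. matrix_inv A $ k $ l)) F"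
    by (intro tendsto_vec_lambda)
  then show ?thesis by simp
qed

section \<open>Weyl sets of a Dirac system\<close>

lemma stack_injective: "stack \<phi> *v c = 0 \<Longrightarrow> c = 0"
  by (metis row_stack_vector(1) matrix_vector_mult_0_right)

lemma stack_vector_nth:
  "(stack \<phi> *v c) $ Inl p = c $ p" "(stack \<phi> *v c) $ Inr r = (\<phi> *v c) $ r"
  by (metis row_I0_vector row_stack_vector(1), metis row_0I_vector row_stack_vector(2))

lemma continuous_on_stack_vector: "continuous_on S (\<lambda>\<phi>. stack \<phi> *v c)"
proof -
  have "continuous_on S (\<lambda>\<phi>. (stack \<phi> *v c) $ i)" for i
    by (cases i) (auto simp: stack_vector_nth intro!: continuous_intros
      bounded_linear.continuous_on[OF bounded_bilinear.bounded_linear_left[OF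
          bounded_bilinear_matrix_vector_mult]])
  then have "continuous_on S (\<lambda>\<phi>. \<chi> i. (stack \<phi> *v c) $ i)"
    by (intro continuous_on_vec_lambda)
  then show ?thesis by simp
qed

text \<open>The constant \<open>P = U z ** stack \<phi>\<close> gives the quotient
  \<open>\<phi>\<close> at \<open>z\<close> itself; at nearby \<open>\<zeta>\<close> the quotient
  may differ. Continuity of \<open>U\<close> at \<open>z\<close> makes it converge to
  \<open>\<phi>\<close>, and this limit is the value that \<open>remove_sings\<close>
  assigns.\<close>

lemma weyl_setI:
  assumes lim: "(U \<longlongrightarrow> U z) (at z)" and inv: "invertible (U z)"
    and nonneg: "\<And>c. 0 \<le> jform (U z *v (stack \<phi> *v c))"
  shows "\<phi> \<in> weyl_set M U z"
proof -
  define P where "P = U z ** stack \<phi>"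
  have Pv: "P *v c = U z *v (stack \<phi> *v c)" for c
    by (simp add: P_def matrix_vector_mul_assoc)
  have "pos_def (ctranspose P ** P)"
  proof -
    have "x \<bullet> ((ctranspose P ** P) *v x) = (norm (P *v x))\<^sup>2" for x
      by (simp add: power2_norm_eq_inner inner_ctranspose flip: matrix_vector_mul_assoc)
    moreover have "P *v x \<noteq> 0" if "x \<noteq> 0" for x
      using that inv stack_injective unfolding Pv invertible_iff_kernel by blast
    ultimately show ?thesis
      by (auto simp: pos_def_def ctranspose_mult)
  qed
  moreover have "pos_semidef (ctranspose P ** j_mat ** P)"
  proof -
    have "x \<bullet> ((ctranspose P ** j_mat ** P) *v x) = jform (P *v x)" for x
      by (simp add: jform_def inner_ctranspose flip: matrix_vector_mul_assoc)
    then show ?thesis using nonneg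
      by (auto simp: pos_semidef_def ctranspose_mult matrix_mul_assoc Pv)
  qed
  ultimately have "(\<lambda>_. P) \<in> P_class M"
    by (auto simp: P_class_def)
  moreover have "\<phi> = (\<chi> i k. remove_sings (\<lambda>\<zeta>. weyl_quotient U (\<lambda>_. P) \<zeta> $ i $ k) z)"
  proof -
    note tm = bounded_bilinear.tendsto[OF bounded_bilinear_matrix_mult]
    have Ui: "((\<lambda>\<zeta>. matrix_inv (U \<zeta>)) \<longlongrightarrow> matrix_inv (U z)) (at z)"
      by (rule tendsto_matrix_inv[OF lim inv])
    have P: "matrix_inv (U z) ** P = stack \<phi>"
      by (simp add: P_def matrix_mul_assoc matrix_inv_mult inv)
    have row: "((\<lambda>\<zeta>. B ** matrix_inv (U \<zeta>) ** P) \<longlongrightarrow> B ** stack \<phi>) (at z)" for B :: "complex^_^'d"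
    proof -
      have "((\<lambda>\<zeta>. B ** matrix_inv (U \<zeta>) ** P) \<longlongrightarrow> B ** matrix_inv (U z) ** P) (at z)"
        by (intro tm Ui tendsto_const)
      then show ?thesis by (simp add: P flip: matrix_mul_assoc)
    qed
    \<comment> \<open>The denominator of the quotient tends to
      \<open>row_I0 ** stack \<phi>\<close>, which is the identity.\<close>
    have one: "invertible (mat 1 :: complex^'a^'a)" "matrix_inv (mat 1) = (mat 1 :: complex^'a^'a)"
      using matrix_inv_mult(1)[of "mat 1 :: complex^'a^'a"] by (auto simp: invertible_def)
    have "((\<lambda>\<zeta>. weyl_quotient U (\<lambda>_. P) \<zeta>) \<longlongrightarrow> \<phi> ** matrix_inv (mat 1)) (at z)"
      unfolding weyl_quotient_def
      using row[of row_0I] row[of row_I0] one(1)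
      by (intro tm tendsto_matrix_inv) auto
    then have "((\<lambda>\<zeta>. weyl_quotient U (\<lambda>_. P) \<zeta> $ i $ k) \<longlongrightarrow> \<phi> $ i $ k) (at z)" for i k
      unfolding one by (auto intro!: tendsto_vec_nth)
    then have "remove_sings (\<lambda>\<zeta>. weyl_quotient U (\<lambda>_. P) \<zeta> $ i $ k) z = \<phi> $ i $ k" for i k
      by (rule remove_sings_eqI)
    then show ?thesis by (simp add: vec_eq_iff)
  qed
  ultimately show ?thesis unfolding weyl_set_def by blast
qed

section \<open>The Dirac system at a fixed time\<close>

definition dirac :: "complex^'m2^'m1 \<Rightarrow> complex \<Rightarrow> complex^('m1::finite + 'm2::finite)^('m1 + 'm2)"
  where "dirac q z = (\<i> * z) \<cdot> j_mat + j_mat ** offdiag q"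

lemma j_cancel [simp]: "j_mat ** (j_mat ** A) = A"
  by (simp add: matrix_mul_assoc j_mat_square)

text \<open>Since \<open>j^2 = I\<close>, multiplying by \<open>j\<close> turns \<open>G\<close>
  into a scalar matrix plus the Hermitian \<open>V\<close>.\<close>

lemma j_mat_dirac: "j_mat *v (dirac q z *v w) = (\<i> * z) *s w + offdiag q *v w"
proof -
  have "j_mat ** dirac q z = (\<i> * z) \<cdot> mat 1 + offdiag q"
    by (simp add: dirac_def matrix_add_ldistrib j_mat_square)
  then show ?thesis
    by (simp add: matrix_vector_mul_assoc matrix_vector_mult_add_rdistrib cscale_vector_mult)
qed

lemma continuous_on_dirac:
  assumes "continuous_on S q"
  shows "continuous_on S (\<lambda>s. dirac (q s) z)"
  unfolding dirac_def
  by (intro continuous_intros assms bounded_linear.continuous_on[OF bounded_linear_offdiag]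
     bounded_linear.continuous_on[OF bounded_bilinear.bounded_linear_right[OF
         bounded_bilinear_matrix_mult]])

lemma inner_smult: "w \<bullet> (c *s w) = Re c * (norm w)\<^sup>2" for w :: "complex^'n"
proof -
  have "x \<bullet> (c * x) = Re c * (x \<bullet> x)" for x
    by (simp add: inner_complex_def algebra_simps)
  then show ?thesis by (simp add: inner_vec_def power2_norm_eq_inner sum_distrib_left)
qed

text \<open>This is half the derivative of \<open>[y]\<close> along a solution. The scalar part
  contributes exactly \<open>- Im z |w|^2\<close>, and \<open>V\<close> can offset at most
  \<open>M |w|^2\<close>; hence the half-plane \<open>Im z > M\<close>.\<close>

lemma inner_j_dirac_le:
  assumes "opnorm q \<le> M"
  shows "(j_mat *v w) \<bullet> (dirac q z *v w) \<le> - (Im z - M) * (norm w)\<^sup>2"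
proof -
  have "(j_mat *v w) \<bullet> (dirac q z *v w) = w \<bullet> ((\<i> * z) *s w + offdiag q *v w)"
    by (simp add: inner_ctranspose j_mat_dirac)
  also have "\<dots> = - Im z * (norm w)\<^sup>2 + w \<bullet> (offdiag q *v w)"
    by (simp add: inner_add_right inner_smult)
  also have "w \<bullet> (offdiag q *v w) \<le> norm w * (M * norm w)"
    by (intro order.trans[OF norm_cauchy_schwarz] mult_left_mono norm_offdiag_le assms) auto
  finally show ?thesis by (simp add: algebra_simps power2_eq_square)
qed

lemma norm_dirac_le:
  assumes "opnorm q \<le> M"
  shows "norm (dirac q z *v w) \<le> (cmod z + M) * norm w"
proof -
  have "norm (dirac q z *v w) = norm ((\<i> * z) *s w + offdiag q *v w)"
    by (simp flip: j_mat_dirac)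
  also have "\<dots> \<le> cmod z * norm w + M * norm w"
    by (intro order.trans[OF norm_triangle_ineq] add_mono norm_offdiag_le assms)
       (simp add: norm_vector_smult_complex norm_mult)
  finally show ?thesis by (simp add: algebra_simps)
qed

lemma has_real_derivative_jform:
  assumes "(w has_vector_derivative w') (at s within S)"
  shows "((\<lambda>s. jform (w s)) has_real_derivative 2 * ((j_mat *v w s) \<bullet> w')) (at s within S)"
proof -
  have "((\<lambda>s. j_mat *v w s) has_vector_derivative j_mat *v w') (at s within S)"
    by (rule bounded_linear.has_vector_derivative[OF matrix_vector_mul_bounded_linear assms])
  then have "((\<lambda>s. w s \<bullet> (j_mat *v w s)) has_vector_derivative (w s \<bullet> (j_mat *v w') + w' \<bullet>
      (j_mat *v w s))) (at s within S)"
    by (rule bounded_bilinear.has_vector_derivative[OF bounded_bilinear_inner assms])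
  moreover have "w s \<bullet> (j_mat *v w') = (j_mat *v w s) \<bullet> w'" by (simp add: inner_ctranspose)
  ultimately show ?thesis
    by (simp add: jform_def has_real_derivative_iff_has_vector_derivative inner_commute)
qed

text \<open>If the upper component of \<open>W c\<close> vanishes, nonnegativity of the form forces
  the lower one to vanish too, so \<open>W c = 0\<close>.\<close>

lemma invertible_upper_block:
  fixes W :: "complex^'m1^('m1::finite + 'm2::finite)"
  assumes inj: "\<And>c. W *v c = 0 \<Longrightarrow> c = 0" and nonneg: "\<And>c. 0 \<le> jform (W *v c)"
  shows "invertible (row_I0 ** W)"
  unfolding invertible_iff_kernel
proof safe
  fix c assume 0: "(row_I0 ** W) *v c = 0"
  then have upper: "row_I0 *v (W *v c) = 0" by (simp add: matrix_vector_mul_assoc)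
  then have "row_0I *v (W *v c) = 0" using nonneg[of c] by (simp add: jform_blocks)
  with upper have "(norm (W *v c))\<^sup>2 = 0" unfolding norm_blocks by simp
  then show "c = 0" using inj by simp
qed

text \<open>One time slice: \<open>q\<close> is \<open>v\<close> and \<open>U\<close> is
  \<open>u\<close> at that time. The equation is required for every complex \<open>z\<close>, so
  that solutions at neighbouring spectral parameters can be compared.\<close>

locale dirac_system =
  fixes q :: "real \<Rightarrow> complex^'m2^'m1" and M :: real
    and U :: "real \<Rightarrow> complex \<Rightarrow> complex^('m1::finite + 'm2::finite)^('m1 + 'm2)"
  assumes continuous_q: "continuous_on {0..} q"
    and q_bound: "\<And>x. 0 \<le> x \<Longrightarrow> opnorm (q x) \<le> M"
    and ode: "\<And>x z. 0 \<le> x \<Longrightarrow>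
      ((\<lambda>s. U s z) has_vector_derivative dirac (q x) z ** U x z) (at x within {0..})"
    and init: "\<And>z. U 0 z = mat 1"
begin

lemma solution_deriv:
  assumes "0 \<le> x"
  shows "((\<lambda>s. U s z *v c) has_vector_derivative dirac (q x) z *v (U x z *v c)) (at x within {0..})"
  using bounded_linear.has_vector_derivative[OF bounded_bilinear.bounded_linear_left[OF
      bounded_bilinear_matrix_vector_mult] ode[OF assms]]
  by (simp add: matrix_vector_mul_assoc)

text \<open>With \<open>\<eta> = 0\<close> this is monotonicity of the form. A positive lower bound
  \<open>\<eta>\<close> on \<open>|y|^2\<close> gives a fixed rate of decrease, which eventually
  makes the form negative.\<close>

lemma jform_decay:
  assumes "M < Im z" "0 \<le> a" "a \<le> b" "\<And>s. s \<in> {a..b} \<Longrightarrow> \<eta> \<le> (norm (U s z *v c))\<^sup>2"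
  shows "jform (U b z *v c) \<le> jform (U a z *v c) + (- 2 * (Im z - M) * \<eta>) * (b - a)"
proof (rule increment_le)
  fix s assume s: "s \<in> {a..b}"
  let ?w = "U s z *v c"
  show "((\<lambda>s. jform (U s z *v c)) has_real_derivative 2 * ((j_mat *v ?w) \<bullet> (dirac (q s) z *v
      ?w))) (at s within {0..})"
    using s \<open>0 \<le> a\<close> by (intro has_real_derivative_jform solution_deriv) simp
  have "2 * ((j_mat *v ?w) \<bullet> (dirac (q s) z *v ?w)) \<le> - 2 * (Im z - M) * (norm ?w)\<^sup>2"
    using inner_j_dirac_le[OF q_bound, of s ?w z] s \<open>0 \<le> a\<close> by (simp add: algebra_simps)
  also have "\<dots> \<le> - 2 * (Im z - M) * \<eta>"
    using assms(4)[OF s] assms(1) by (intro mult_left_mono_neg) auto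
  finally show "2 * ((j_mat *v ?w) \<bullet> (dirac (q s) z *v ?w)) \<le> - 2 * (Im z - M) * \<eta>" .
qed (use assms in auto)

lemma jform_decreasing:
  assumes "M < Im z" "0 \<le> a" "a \<le> b"
  shows "jform (U b z *v c) \<le> jform (U a z *v c)"
  using jform_decay[OF assms, of 0 c] by simp

text \<open>Gronwall for \<open>- |y|^2\<close> shows that \<open>|y|^2\<close> cannot shrink faster
  than \<open>exp (- 2 (|z| + M) x)\<close>, so a nonzero initial vector never reaches zero.\<close>

lemma invertible_solution:
  assumes "0 \<le> x"
  shows "invertible (U x z)"
  unfolding invertible_iff_kernel
proof safe
  fix c assume 0: "U x z *v c = 0"
  let ?K = "2 * (cmod z + M)"
  have "- (norm (U x z *v c))\<^sup>2 \<le> - (norm (U 0 z *v c))\<^sup>2 * exp (- ?K * (x - 0))"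
  proof (rule gronwall)
    fix s assume s: "s \<in> {0..x}"
    let ?w = "U s z *v c"
    show "((\<lambda>s. - (norm (U s z *v c))\<^sup>2) has_real_derivative - (2 * (?w \<bullet> (dirac (q s) z *v
        ?w)))) (at s within {0..})"
      using s by (intro DERIV_minus has_real_derivative_norm_square solution_deriv) simp
    have "norm ?w * norm (dirac (q s) z *v ?w) \<le> norm ?w * ((cmod z + M) * norm ?w)"
      using s by (intro mult_left_mono norm_dirac_le q_bound) auto
    then have "- (?w \<bullet> (dirac (q s) z *v ?w)) \<le> (cmod z + M) * (norm ?w)\<^sup>2"
      using Cauchy_Schwarz_ineq2[of ?w "dirac (q s) z *v ?w"] by (simp add: power2_eq_square
          algebra_simps)
    then show "- (2 * (?w \<bullet> (dirac (q s) z *v ?w))) \<le> - ?K * - (norm ?w)\<^sup>2" by (simp add: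
        algebra_simps)
  qed (use assms in auto)
  then show "c = 0" using 0 init by (simp add: mult_le_0_iff)
qed

text \<open>The difference of the solutions for \<open>\<zeta>\<close> and \<open>z\<close> starts
  at zero and solves a linear equation whose inhomogeneity has the factor
  \<open>\<zeta> - z\<close>.\<close>

lemma continuous_in_parameter:
  assumes "0 \<le> x"
  shows "((\<lambda>\<zeta>. U x \<zeta>) \<longlongrightarrow> U x z) (at z)"
proof -
  have contU: "continuous_on {0..x} (\<lambda>s. U s z)"
    unfolding continuous_on_eq_continuous_within
    by (intro ballI continuous_within_subset[OF has_vector_derivative_continuous[OF ode]]) auto
  have contG: "continuous_on {0..x} (\<lambda>s. dirac (q s) z)"
    by (intro continuous_on_dirac continuous_on_subset[OF continuous_q]) auto
  from compact_imp_bounded[OF compact_continuous_image[OF contU compact_Icc]]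
  obtain Bu where Bu: "0 < Bu" "\<And>s. s \<in> {0..x} \<Longrightarrow> norm (U s z) \<le> Bu"
    unfolding bounded_pos by auto
  from compact_imp_bounded[OF compact_continuous_image[OF contG compact_Icc]]
  obtain Bg where Bg: "0 < Bg" "\<And>s. s \<in> {0..x} \<Longrightarrow> norm (dirac (q s) z) \<le> Bg"
    unfolding bounded_pos by auto
  obtain K where K: "0 < K" "\<And>(A :: complex^('m1 + 'm2)^('m1 + 'm2)) (B :: complex^('m1 +
      'm2)^('m1 + 'm2)).
      norm (A ** B) \<le> norm A * norm B * K"
    using bounded_bilinear.pos_bounded[OF bounded_bilinear_matrix_mult] by blast
  define J where "J = norm (j_mat :: complex^('m1 + 'm2)^('m1 + 'm2))"
  have J: "0 \<le> J" by (simp add: J_def)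
  let ?a = "(Bg + J) * K"
  \<comment> \<open>Distance at most 1 bounds \<open>dirac (q s) \<zeta>\<close> by
    \<open>Bg + J\<close> independently of \<open>\<zeta>\<close>, so the exponential factor is a
    constant.\<close>
  have est: "norm (U x \<zeta> - U x z) \<le> (cmod (\<zeta> - z) * (J * Bu * K)) * exp ((?a + 1) * (x - 0))"
    if \<zeta>: "cmod (\<zeta> - z) \<le> 1" for \<zeta>
  proof (rule norm_le_gronwall)
    fix s assume s: "s \<in> {0..x}"
    let ?D = "U s \<zeta> - U s z"
    have split: "dirac (q s) \<zeta> = dirac (q s) z + (\<i> * (\<zeta> - z)) \<cdot> j_mat"
      by (simp add: dirac_def vec_eq_iff algebra_simps)
    show "((\<lambda>s. U s \<zeta> - U s z) has_vector_derivative dirac (q s) \<zeta> ** U s \<zeta> - dirac (q s) z ** U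
        s z) (at s within {0..})"
      using s by (intro has_vector_derivative_diff ode) auto
    have "dirac (q s) \<zeta> ** U s \<zeta> - dirac (q s) z ** U s z = dirac (q s) \<zeta> ** ?D + (\<i> * (\<zeta> - z))
        \<cdot> (j_mat ** U s z)"
      unfolding split bounded_bilinear.diff_right[OF bounded_bilinear_matrix_mult]
      by (simp add: bounded_bilinear.add_left[OF bounded_bilinear_matrix_mult])
    also have "norm \<dots> \<le> norm (dirac (q s) \<zeta>) * norm ?D * K + cmod (\<zeta> - z) * (J * norm (U s z) * K)"
      by (intro order.trans[OF norm_triangle_ineq] add_mono K)
         (simp add: norm_cscale norm_mult J_def K mult_left_mono)
    also have "\<dots> \<le> (Bg + J) * norm ?D * K + cmod (\<zeta> - z) * (J * Bu * K)"
    proof (intro add_mono mult_right_mono mult_left_mono)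
      have "norm (dirac (q s) \<zeta>) \<le> norm (dirac (q s) z) + cmod (\<zeta> - z) * J"
        unfolding split J_def by (intro order.trans[OF norm_triangle_ineq]) (simp add:
            norm_cscale norm_mult)
      also have "\<dots> \<le> Bg + J" using Bg(2)[OF s] \<zeta> J by (intro add_mono mult_left_le_one_le) auto
      finally show "norm (dirac (q s) \<zeta>) \<le> Bg + J" .
    qed (use Bu(2)[OF s] K(1) J in auto)
    finally show "norm (dirac (q s) \<zeta> ** U s \<zeta> - dirac (q s) z ** U s z) \<le> ?a * norm ?D + cmod
        (\<zeta> - z) * (J * Bu * K)"
      by (simp add: mult_ac)
  qed (use assms Bg Bu K J init in auto)
  have ev: "\<forall>\<^sub>F \<zeta> in at z. norm (U x \<zeta> - U x z) \<le> (cmod (\<zeta> - z) * (J * Bu * K)) * exp ((?a + 1)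
      * (x - 0))"
    unfolding eventually_at
    by (intro exI[of _ 1] conjI ballI impI est) (simp_all add: dist_norm)
  have "((\<lambda>\<zeta>. (cmod (\<zeta> - z) * (J * Bu * K)) * exp ((?a + 1) * (x - 0))) \<longlongrightarrow> (cmod (z - z) * (J *
      Bu * K)) * exp ((?a + 1) * (x - 0))) (at z)"
    by (intro tendsto_intros)
  then have "((\<lambda>\<zeta>. U x \<zeta> - U x z) \<longlongrightarrow> 0) (at z)"
    by (intro Lim_null_comparison[OF ev]) simp
  then show ?thesis by (rule LIM_zero_cancel)
qed

text \<open>A Weyl disc, described at a single \<open>z\<close>: no function of the spectral
  parameter occurs, so nesting and compactness are finite-dimensional questions.\<close>

definition admissible :: "real \<Rightarrow> complex \<Rightarrow> (complex^'m1^'m2) set"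
  where "admissible x z = {\<phi>. \<forall>c. 0 \<le> jform (U x z *v (stack \<phi> *v c))}"

lemma admissible_subset_weyl_set: "0 \<le> x \<Longrightarrow> admissible x z \<subseteq> weyl_set M (U x) z"
  by (auto simp: admissible_def intro!: weyl_setI continuous_in_parameter invertible_solution)

text \<open>The column \<open>[I; \<phi>]\<close> equals \<open>W\<close> times the inverse of its
  upper block, so the condition on \<open>\<phi>\<close> is the one on \<open>W\<close> at other
  vectors. Nonnegativity of \<open>W\<close> itself makes that block invertible.\<close>

lemma quotient_admissible:
  fixes W :: "complex^'m1^('m1 + 'm2)"
  assumes inj: "\<And>c. W *v c = 0 \<Longrightarrow> c = 0" and nonneg: "\<And>c. 0 \<le> jform (W *v c)"
    and "\<And>c. 0 \<le> jform (U x z *v (W *v c))"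
  shows "row_0I ** W ** matrix_inv (row_I0 ** W) \<in> admissible x z"
proof -
  let ?A = "row_I0 ** W" and ?\<phi> = "row_0I ** W ** matrix_inv (row_I0 ** W)"
  have inv: "invertible ?A" by (rule invertible_upper_block[OF inj nonneg])
  have "stack ?\<phi> *v c = W *v (matrix_inv ?A *v c)" for c
  proof -
    have "stack ?\<phi> = stack ?\<phi> ** (?A ** matrix_inv ?A)"
      by (simp only: matrix_inv_mult[OF inv] matrix_mul_rid)
    also have "\<dots> = W ** matrix_inv ?A"
      by (simp only: matrix_mul_assoc[of "stack ?\<phi>" ?A] stack_decompose[OF inv])
    finally show ?thesis by (simp only: matrix_vector_mul_assoc)
  qed
  then show ?thesis using assms(3) by (simp add: admissible_def)
qed

text \<open>The column \<open>[I; 0]\<close>, where the form is nonnegative, is pulled back from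
  \<open>x\<close> to \<open>0\<close>. The form decreases in \<open>x\<close>, so the pulled back
  column is nonnegative as well and its quotient is admissible.\<close>

lemma admissible_nonempty:
  assumes "M < Im z" "0 \<le> x"
  shows "admissible x z \<noteq> {}"
proof -
  define W where "W = matrix_inv (U x z) ** (stack 0 :: complex^'m1^('m1 + 'm2))"
  have UW: "U x z *v (W *v c) = stack 0 *v c" for c
    using matrix_inv_mult[OF invertible_solution[OF assms(2), of z]]
    unfolding W_def matrix_vector_mul_assoc by (metis matrix_mul_assoc matrix_mul_lid)
  have nonneg: "0 \<le> jform (U x z *v (W *v c))" for c
    unfolding UW by (simp add: jform_blocks)
  moreover have "0 \<le> jform (W *v c)" for c
    using order.trans[OF nonneg jform_decreasing[OF assms(1) order.refl assms(2)]] by (simp add: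
        init)
  moreover have "c = 0" if "W *v c = 0" for c
    using UW[of c] stack_injective[of 0 c] that by simp
  ultimately show ?thesis using quotient_admissible by blast
qed

lemma admissible_antimono:
  "M < Im z \<Longrightarrow> 0 \<le> x \<Longrightarrow> x \<le> y \<Longrightarrow> admissible y z \<subseteq> admissible x z"
  unfolding admissible_def using order.trans[OF _ jform_decreasing] by blast

text \<open>Each vector \<open>c\<close> imposes a closed condition. Boundedness is inherited from
  \<open>x = 0\<close>, where the condition says that \<open>\<phi>\<close> is a
  contraction.\<close>

lemma compact_admissible:
  assumes "M < Im z" "0 \<le> x"
  shows "compact (admissible x z)"
proof -
  have "closed {\<phi>. 0 \<le> jform (U x z *v (stack \<phi> *v c))}" for c
    unfolding jform_def
    by (intro closed_Collect_le continuous_on_const continuous_on_inner continuous_on_stack_vector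
      bounded_linear.continuous_on[OF matrix_vector_mul_bounded_linear])
  then have "closed (\<Inter>c. {\<phi>. 0 \<le> jform (U x z *v (stack \<phi> *v c))})" by blast
  then have "closed (admissible x z)" by (simp add: admissible_def Collect_all_eq)
  moreover have "bounded (admissible 0 z)"
  proof -
    \<comment> \<open>The entries of a contraction have modulus at most 1, so the number of entries
      is a crude bound.\<close>
    have "norm \<phi> \<le> (\<Sum>i\<in>(UNIV::'m2 set). \<Sum>k\<in>(UNIV::'m1 set). 1)" if "\<phi> \<in> admissible 0 z" for \<phi>
    proof -
      have entry: "norm (\<phi> $ i $ k) \<le> 1" for i k
      proof -
        have "0 \<le> jform (stack \<phi> *v axis k 1)" using that by (simp add: admissible_def init)
        then have "(norm (\<phi> *v axis k 1))\<^sup>2 \<le> 1" by (simp add: jform_blocks)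
        then have "norm (\<phi> *v axis k 1) \<le> 1" by (simp add: power_le_one_iff)
        moreover have "(\<phi> *v axis k 1) $ i = \<phi> $ i $ k"
          by (simp add: matrix_vector_mult_def axis_def if_distrib[of "\<lambda>x. _ * x"] cong: if_cong)
        ultimately show ?thesis using Finite_Cartesian_Product.norm_nth_le[of "\<phi> *v axis k 1" i]
            by simp
      qed
      then have "norm (\<phi> $ i) \<le> (\<Sum>k\<in>(UNIV::'m1 set). 1)" for i
        unfolding norm_vec_def[of "\<phi> $ i"] by (intro order.trans[OF L2_set_le_sum] sum_mono) auto
      then show ?thesis
        unfolding norm_vec_def[of \<phi>] by (intro order.trans[OF L2_set_le_sum] sum_mono) auto
    qed
    then show ?thesis unfolding bounded_iff by blast
  qed
  then have "bounded (admissible x z)"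
    by (rule bounded_subset) (rule admissible_antimono[OF assms(1) order.refl assms(2)])
  ultimately show ?thesis by (simp add: compact_eq_bounded_closed)
qed

lemma weyl_function_characterization:
  assumes "M < Im z" and weyl: "{\<psi>} = (\<Inter>x\<in>{0..}. weyl_set M (U x) z)"
  shows "(\<forall>x\<ge>0. \<phi> \<in> admissible x z) \<longleftrightarrow> \<phi> = \<psi>"
proof -
  have unique: "\<phi> = \<psi>" if "\<forall>x\<ge>0. \<phi> \<in> admissible x z" for \<phi>
  proof -
    have "\<phi> \<in> (\<Inter>x\<in>{0..}. weyl_set M (U x) z)"
      using that subsetD[OF admissible_subset_weyl_set] by simp
    then show ?thesis unfolding weyl[symmetric] by simp
  qed
  \<comment> \<open>A point common to the discs at integer positions lies in the disc at every real
    \<open>x\<close>, by antimonotonicity and the ceiling of \<open>x\<close>.\<close>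
  have "\<Inter>(range (\<lambda>n::nat. admissible (real n) z)) \<noteq> {}"
    by (rule compact_nest)
       (simp_all add: compact_admissible admissible_nonempty admissible_antimono assms(1))
  then obtain \<phi> where \<phi>: "\<And>n::nat. \<phi> \<in> admissible (real n) z" by blast
  have "\<phi> \<in> admissible x z" if "0 \<le> x" for x
    using admissible_antimono[OF assms(1) that real_nat_ceiling_ge] \<phi> by blast
  then show ?thesis using unique by blast
qed

end

section \<open>The zero curvature equation\<close>

lemma matrix_mult_minus [simp]:
  "A ** (- B) = - (A ** B)" "(- A) ** B = - (A ** B)" for A :: "complex^'b^'a"
  by (simp_all add: vec_eq_iff matrix_matrix_mult_def sum_negf)

text \<open>\<open>V^3\<close> is again off-diagonal, with blocks \<open>q q* q\<close> and
  \<open>q* q q*\<close>, so the nonlinearity of the NLS equation becomes a product of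
  matrices.\<close>

lemma offdiag_cube: "offdiag (q ** ctranspose q ** q) = offdiag q ** (offdiag q ** offdiag q)"
proof -
  have mult: "(offdiag q ** A) $ Inl p $ k = (\<Sum>r\<in>UNIV. q $ p $ r * A $ Inr r $ k)"
    "(offdiag q ** A) $ Inr r $ k = (\<Sum>p\<in>UNIV. cnj (q $ p $ r) * A $ Inl p $ k)"
    for A :: "complex^'d^('a + 'b)" and p r k
    unfolding matrix_matrix_mult_def by (simp_all add: UNIV_sum_split)
  have entry: "(q ** ctranspose q ** q) $ p $ r
      = (\<Sum>r'\<in>UNIV. q $ p $ r' * (\<Sum>p'\<in>UNIV. cnj (q $ p' $ r') * q $ p' $ r))" for p r
    unfolding matrix_mul_assoc[symmetric] by (simp add: matrix_matrix_mult_def)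
  have swap: "(\<Sum>p'\<in>UNIV. cnj (q $ p' $ r) * (\<Sum>r'\<in>UNIV. q $ p' $ r' * cnj (q $ p $ r')))
      = (\<Sum>r'\<in>UNIV. cnj (q $ p $ r') * (\<Sum>p'\<in>UNIV. q $ p' $ r' * cnj (q $ p' $ r)))" for p r
    unfolding sum_distrib_left by (subst sum.swap) (simp add: mult_ac)
  show ?thesis
    by (simp add: vec_eq_iff all_sum_iff mult entry swap)
qed

lemma offdiag_j_left: "offdiag q ** (j_mat ** A) = - (j_mat ** (offdiag q ** A))"
  by (simp add: matrix_mul_assoc offdiag_j)

lemma offdiag_add: "offdiag (p + q) = offdiag p + offdiag q"
  by (simp add: vec_eq_iff all_sum_iff)

text \<open>Conjugation turns \<open>\<i>\<close> into \<open>- \<i>\<close> in the lower block, and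
  the sign of \<open>j\<close> there restores it.\<close>

lemma j_offdiag_cscale_i: "j_mat ** offdiag (\<i> \<cdot> q) = \<i> \<cdot> offdiag q"
  by (simp add: vec_eq_iff all_sum_iff j_mat_mult)

lemma offdiag_scaleR: "offdiag (r *\<^sub>R q) = complex_of_real r \<cdot> offdiag q"
  by (simp add: vec_eq_iff all_sum_iff scaleR_conv_of_real[where 'a=complex])

text \<open>\<open>F\<close> at a point with \<open>v = q\<close> and \<open>v_x = p\<close>, the
  two values being treated as independent.\<close>

definition nls_flow :: "complex^'m2^'m1 \<Rightarrow> complex^'m2^'m1 \<Rightarrow> complex
    \<Rightarrow> complex^('m1::finite + 'm2::finite)^('m1 + 'm2)"
  where "nls_flow q p z = \<i> \<cdot> (z\<^sup>2 \<cdot> j_mat - (\<i> * z) \<cdot> (j_mat ** offdiag q)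
         - (1 / 2) \<cdot> (offdiag p + j_mat ** (offdiag q ** offdiag q)))"

text \<open>The formal \<open>x\<close>-derivative of \<open>nls_flow\<close>, with \<open>r\<close>
  standing for \<open>v_xx\<close>.\<close>

definition nls_flow_x :: "complex^'m2^'m1 \<Rightarrow> complex^'m2^'m1 \<Rightarrow> complex^'m2^'m1 \<Rightarrow> complex
    \<Rightarrow> complex^('m1::finite + 'm2::finite)^('m1 + 'm2)"
  where "nls_flow_x q p r z = \<i> \<cdot> (- ((\<i> * z) \<cdot> (j_mat ** offdiag p))
         - (1 / 2) \<cdot> (offdiag r + j_mat ** (offdiag p ** offdiag q + offdiag q ** offdiag p)))"

text \<open>This is \<open>F_x = G_t + G F - F G\<close>. In the commutator all powers of
  \<open>z\<close> above the first cancel, and its cubic term in \<open>V\<close> cancels against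
  the nonlinearity in \<open>q_t\<close>.\<close>

lemma zero_curvature:
  assumes "2 \<cdot> q_t + \<i> \<cdot> (r + 2 \<cdot> (q ** ctranspose q ** q)) = 0"
  shows "nls_flow_x q p r z =
    j_mat ** offdiag q_t + dirac q z ** nls_flow q p z - nls_flow q p z ** dirac q z"
proof -
  \<comment> \<open>The real factor \<open>- 1 / 2\<close> is put outermost because
    \<open>offdiag\<close> passes real scalars only; the remaining \<open>\<i>\<close> is absorbed
    by \<open>j\<close>.\<close>
  have q_t: "q_t = (- 1 / 2) *\<^sub>R (\<i> \<cdot> (r + 2 *\<^sub>R (q ** ctranspose q ** q)))"
  proof -
    have half: "a = - (b / 2)" if "2 * a + b = 0" for a b :: complex
      using that by (simp add: eq_neg_iff_add_eq_0 field_simps)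
    have "2 * q_t $ i $ k + \<i> * (r $ i $ k + 2 * (q ** ctranspose q ** q) $ i $ k) = 0" for i k
      using arg_cong[OF assms, of "\<lambda>A. A $ i $ k"]
      unfolding vector_add_component cscale_nth zero_index .
    from half[OF this] show ?thesis
      by (simp add: vec_eq_iff scaleR_conv_of_real[where 'a=complex])
  qed
  have qt: "j_mat ** offdiag q_t =
      (- (\<i> / 2)) \<cdot> (offdiag r + 2 \<cdot> (offdiag q ** (offdiag q ** offdiag q)))"
    unfolding q_t offdiag_scaleR cscale_mult_right j_offdiag_cscale_i offdiag_add offdiag_cube
    by (simp add: vec_eq_iff)
  note bb = bounded_bilinear_matrix_mult
  have comm: "dirac q z ** nls_flow q p z - nls_flow q p z ** dirac q z =
     z \<cdot> (j_mat ** offdiag p) - (\<i> / 2) \<cdot> (j_mat ** (offdiag p ** offdiag q) + j_mat ** (offdiag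
         q ** offdiag p))
     + \<i> \<cdot> (offdiag q ** (offdiag q ** offdiag q))"
    unfolding dirac_def nls_flow_def
    by (simp add: bounded_bilinear.add_left[OF bb] bounded_bilinear.add_right[OF bb]
          bounded_bilinear.diff_left[OF bb] bounded_bilinear.diff_right[OF bb]
          offdiag_j offdiag_j_left j_mat_square flip: matrix_mul_assoc)
       (simp add: vec_eq_iff field_simps power2_eq_square)
  show ?thesis
    unfolding qt nls_flow_x_def add_diff_eq[symmetric] comm
    by (simp add: bounded_bilinear.add_right[OF bb] vec_eq_iff field_simps)
qed

lemma ctranspose_cscale: "ctranspose (c \<cdot> A) = cnj c \<cdot> ctranspose A"
  by (simp add: vec_eq_iff)

lemma ctranspose_add: "ctranspose (A + B) = ctranspose A + ctranspose B"
  by (simp add: vec_eq_iff)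

text \<open>The term with \<open>p\<close> is skew-Hermitian, so it does not contribute.\<close>

lemma inner_nls_flow_le:
  assumes "opnorm q \<le> M"
  shows "\<bar>w \<bullet> (nls_flow q p z *v w)\<bar> \<le> ((cmod z)\<^sup>2 + cmod z * M) * (norm w)\<^sup>2"
proof -
  define H where "H = (- (\<i> / 2)) \<cdot> (offdiag p + j_mat ** (offdiag q ** offdiag q))"
  have "ctranspose H = - H"
  proof -
    have "ctranspose (offdiag p + j_mat ** (offdiag q ** offdiag q)) = offdiag p + j_mat **
        (offdiag q ** offdiag q)"
    proof -
      \<comment> \<open>\<open>j\<close> anticommutes with each factor, hence commutes with
        \<open>V^2\<close>; so \<open>j V^2\<close> is Hermitian and can join the term with
        \<open>p\<close> in \<open>H\<close>.\<close>
      have "offdiag q ** offdiag q ** j_mat = j_mat ** (offdiag q ** offdiag q)"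
        unfolding matrix_mul_assoc[symmetric] offdiag_j
        by (simp add: matrix_mul_assoc offdiag_j)
      then show ?thesis by (simp add: ctranspose_mult ctranspose_add)
    qed
    then show ?thesis by (simp add: H_def ctranspose_cscale) (simp add: vec_eq_iff)
  qed
  then have skew: "w \<bullet> (H *v w) = 0" by (rule skew_inner_zero)
  have "nls_flow q p z = (\<i> * z\<^sup>2) \<cdot> j_mat + z \<cdot> (j_mat ** offdiag q) + H"
    unfolding nls_flow_def H_def by (simp add: vec_eq_iff field_simps)
  then have "w \<bullet> (nls_flow q p z *v w) = w \<bullet> ((\<i> * z\<^sup>2) *s (j_mat *v w)) + w \<bullet> (z *s (j_mat *v
      (offdiag q *v w)))"
    by (simp add: matrix_vector_mult_add_rdistrib inner_add_right skew cscale_vector_mult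
        matrix_vector_mul_assoc)
  also have "\<bar>\<dots>\<bar> \<le> norm w * norm ((\<i> * z\<^sup>2) *s (j_mat *v w)) + norm w * norm (z *s (j_mat *v
      (offdiag q *v w)))"
    by (intro order.trans[OF abs_triangle_ineq] add_mono Cauchy_Schwarz_ineq2)
  also have "\<dots> \<le> norm w * ((cmod z)\<^sup>2 * norm w) + norm w * (cmod z * (M * norm w))"
    by (intro add_mono mult_left_mono)
       (auto simp: norm_vector_smult_complex norm_mult norm_power intro!: mult_left_mono
           norm_offdiag_le assms)
  finally show ?thesis by (simp add: algebra_simps power2_eq_square)
qed

section \<open>Increments in time, and the matrices of the system in terms of
  \<open>v\<close>\<close>

lemma time_interval_extend:
  assumes "t \<in> time_interval a"
  obtains t' where "t < t'" "{0..t'} \<subseteq> time_interval a"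
proof -
  from assms obtain t' where "ereal t < ereal t'" "ereal t' < a"
    unfolding time_interval_def using ereal_dense2 by blast
  then show thesis
    by (intro that[of t']) (auto simp: time_interval_def intro: le_less_trans[of "ereal _"
        "ereal t'"])
qed

text \<open>The time derivative is uniformly continuous on a compact rectangle reaching beyond
  \<open>t\<close>, so one \<open>\<delta>\<close> serves all \<open>s\<close> in
  \<open>{0..x}\<close>.\<close>

lemma uniform_time_increment:
  fixes f :: "real \<Rightarrow> real \<Rightarrow> 'a::real_normed_vector"
  assumes C1: "continuously_differentiable a f" and t: "t \<in> time_interval a" and "0 < \<epsilon>"
  obtains \<delta> where "0 < \<delta>"
    "\<And>s \<tau>. \<lbrakk>s \<in> {0..x}; \<tau> \<in> time_interval a; \<bar>\<tau> - t\<bar> < \<delta>\<rbrakk> \<Longrightarrow>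
      norm (f s \<tau> - f s t - (\<tau> - t) *\<^sub>R Dt a f s t) \<le> \<bar>\<tau> - t\<bar> * \<epsilon>"
proof -
  obtain t' where t': "t < t'" "{0..t'} \<subseteq> time_interval a" using time_interval_extend[OF t] .
  have t0: "0 \<le> t" using t by (simp add: time_interval_def)
  let ?K = "{0..x} \<times> {0..t'}"
  have "continuous_on ?K (\<lambda>(x, t). Dt a f x t)"
    using C1 t'(2) unfolding continuously_differentiable_def
    by (auto simp: semistrip_def intro: continuous_on_subset)
  then have "uniformly_continuous_on ?K (\<lambda>(x, t). Dt a f x t)"
    by (intro compact_uniformly_continuous compact_Times) auto
  then obtain \<delta>' where \<delta>': "0 < \<delta>'"
    "\<And>y y'. \<lbrakk>y \<in> ?K; y' \<in> ?K; dist y' y < \<delta>'\<rbrakk> \<Longrightarrow>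
       dist ((\<lambda>(x, t). Dt a f x t) y') ((\<lambda>(x, t). Dt a f x t) y) < \<epsilon>"
    unfolding uniformly_continuous_on_def using \<open>0 < \<epsilon>\<close> by meson
  have "norm (f s \<tau> - f s t - (\<tau> - t) *\<^sub>R Dt a f s t) \<le> \<bar>\<tau> - t\<bar> * \<epsilon>"
    \<comment> \<open>The second entry of the minimum keeps \<open>\<tau>\<close> inside the
      rectangle.\<close>
    if s: "s \<in> {0..x}" and \<tau>: "\<tau> \<in> time_interval a" "\<bar>\<tau> - t\<bar> < min \<delta>' (t' - t)" for s \<tau>
  proof -
    have \<tau>': "\<tau> \<in> {0..t'}" using \<tau> by (auto simp: time_interval_def)
    then have sub: "closed_segment t \<tau> \<subseteq> {0..t'}"
      using t0 t'(1) by (intro closed_segment_subset) auto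
    have deriv: "((\<lambda>\<tau>. f s \<tau>) has_vector_derivative Dt a f s \<sigma>) (at \<sigma> within closed_segment t \<tau>)"
      if "\<sigma> \<in> closed_segment t \<tau>" for \<sigma>
    proof -
      have "(s, \<sigma>) \<in> semistrip a" using that sub t'(2) s by (auto simp: semistrip_def)
      then have "((\<lambda>\<tau>. f s \<tau>) has_vector_derivative Dt a f s \<sigma>) (at \<sigma> within time_interval a)"
        using C1 unfolding continuously_differentiable_def t_differentiable_def Dt_def
        by (auto simp flip: vector_derivative_works)
      then show ?thesis by (rule has_vector_derivative_within_subset) (use sub t'(2) in blast)
    qed
    have "norm (f s \<tau> - f s t - (\<tau> - t) *\<^sub>R Dt a f s t) \<le> norm (\<tau> - t) * \<epsilon>"
    proof (rule vector_differentiable_bound_linearization[OF deriv])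
      fix \<sigma> assume \<sigma>: "\<sigma> \<in> closed_segment t \<tau>"
      then have "\<bar>\<sigma> - t\<bar> \<le> \<bar>\<tau> - t\<bar>" by (auto simp: closed_segment_eq_real_ivl split: if_splits)
      then have "dist (s, \<sigma>) (s, t) < \<delta>'" using \<tau> by (simp add: dist_Pair_Pair dist_real_def)
      from \<delta>'(2)[OF _ _ this] show "norm (Dt a f s \<sigma> - Dt a f s t) \<le> \<epsilon>"
        using s \<sigma> sub t0 t'(1) by (auto simp: dist_norm)
    qed auto
    then show ?thesis by simp
  qed
  with \<delta>'(1) t'(1) show thesis by (intro that[of "min \<delta>' (t' - t)"]) auto
qed

lemma Dx_works:
  assumes "x_differentiable a f" "(x, t) \<in> semistrip a"
  shows "((\<lambda>\<xi>. f \<xi> t) has_vector_derivative Dx f x t) (at x within {0..})"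
  using assms unfolding x_differentiable_def Dx_def by (auto simp flip: vector_derivative_works)

lemma V_mat_offdiag: "V_mat v x t = offdiag (v x t)"
  by (simp add: V_mat_def offdiag_def)

lemma G_mat_dirac: "G_mat v x t z = dirac (v x t) z"
  by (simp add: G_mat_def dirac_def V_mat_offdiag)

lemma F_mat_nls_flow:
  assumes "x_differentiable a v" "(x, t) \<in> semistrip a"
  shows "F_mat v x t z = nls_flow (v x t) (Dx v x t) z"
proof -
  have "((\<lambda>\<xi>. V_mat v \<xi> t) has_vector_derivative offdiag (Dx v x t)) (at x within {0..})"
    unfolding V_mat_offdiag
    by (rule bounded_linear.has_vector_derivative[OF bounded_linear_offdiag Dx_works[OF assms]])
  \<comment> \<open>\<open>x\<close> is not isolated in the half-line, so the one-sided derivative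
    is unique.\<close>
  moreover have "at x within {0..} \<noteq> bot"
    using assms(2) by (auto simp: semistrip_def trivial_limit_within islimpt_greaterThanLessThan2
       intro!: islimpt_subset[of x "{x<..<x+1}" "{0..}"] islimpt_greaterThanLessThan1)
  ultimately have "Dx (V_mat v) x t = offdiag (Dx v x t)"
    unfolding Dx_def by (intro vector_derivative_within)
  then show ?thesis by (simp add: F_mat_def nls_flow_def V_mat_offdiag)
qed

section \<open>Time derivative of the fundamental solution\<close>

text \<open>Intended for \<open>A0\<close>, \<open>A\<close> the values of \<open>G\<close> at two
  times \<open>h\<close> apart, \<open>X'\<close> its time derivative and \<open>w'\<close> the
  candidate for \<open>u_t\<close>. The remainder of \<open>u\<close> then has a derivative linear
  in itself, up to two terms small compared with \<open>h\<close>.\<close>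

lemma difference_derivative_identity:
  fixes A :: "complex^'n^'n"
  assumes "A = A0 + X" and "X = Y + h *\<^sub>R X'"
  shows "A ** w - A0 ** w0 - h *\<^sub>R (X' ** w0 + A0 ** w') = A ** (w - w0 - h *\<^sub>R w') + Y ** w0 +
      h *\<^sub>R (X ** w')"
proof -
  note bb = bounded_bilinear_matrix_mult
  have "X ** w0 = Y ** w0 + h *\<^sub>R (X' ** w0)"
    unfolding assms(2) bounded_bilinear.add_left[OF bb] bounded_bilinear.scaleR_left[OF bb] ..
  moreover have "A ** w0 = A0 ** w0 + X ** w0" "A ** w' = A0 ** w' + X ** w'"
    unfolding assms(1) bounded_bilinear.add_left[OF bb] by (rule refl)+
  ultimately show ?thesis
    by (simp add: bounded_bilinear.diff_right[OF bb] bounded_bilinear.scaleR_right[OF bb]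
        scaleR_add_right)
qed

locale nls_solution =
  fixes v :: "real \<Rightarrow> real \<Rightarrow> complex^'m2^'m1" and a :: ereal and M :: real
    and u :: "real \<Rightarrow> real \<Rightarrow> complex \<Rightarrow> complex^('m1::finite + 'm2::finite)^('m1 + 'm2)"
  assumes v_C1: "continuously_differentiable a v"
    and v_xx: "x_differentiable a (Dx v)"
    and NLS: "focusing_NLS a v"
    and v_bound: "\<And>x t. (x, t) \<in> semistrip a \<Longrightarrow> opnorm (v x t) \<le> M"
    and u_ode: "\<And>x t z. (x, t) \<in> semistrip a \<Longrightarrow>
      ((\<lambda>\<xi>. u \<xi> t z) has_vector_derivative dirac (v x t) z ** u x t z) (at x within {0..})"
    and u_init: "\<And>t z. t \<in> time_interval a \<Longrightarrow> u 0 t z = mat 1"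
begin

lemma v_x_deriv:
  "(x, t) \<in> semistrip a \<Longrightarrow> ((\<lambda>\<xi>. v \<xi> t) has_vector_derivative Dx v x t) (at x within {0..})"
  using v_C1 by (simp add: Dx_works[of a] continuously_differentiable_def)

lemma semistripI: "0 \<le> x \<Longrightarrow> t \<in> time_interval a \<Longrightarrow> (x, t) \<in> semistrip a"
  by (simp add: semistrip_def)

lemma dirac_system_at:
  assumes t: "t \<in> time_interval a"
  shows "dirac_system (\<lambda>x. v x t) M (\<lambda>x z. u x t z)"
proof
  show "continuous_on {0..} (\<lambda>x. v x t)"
    unfolding continuous_on_eq_continuous_within
    by (intro ballI has_vector_derivative_continuous[OF v_x_deriv] semistripI t) simp
qed (use t in \<open>auto intro!: v_bound u_ode u_init semistripI\<close>)

abbreviation flow :: "real \<Rightarrow> real \<Rightarrow> complex \<Rightarrow> complex^('m1 + 'm2)^('m1 + 'm2)"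
  where "flow x t z \<equiv> nls_flow (v x t) (Dx v x t) z"

text \<open>The candidate for \<open>u_t\<close>. It vanishes at \<open>x = 0\<close>, in agreement
  with the constant initial value.\<close>

abbreviation (input) du :: "real \<Rightarrow> real \<Rightarrow> complex \<Rightarrow> complex^('m1 + 'm2)^('m1 + 'm2)"
  where "du x t z \<equiv> flow x t z ** u x t z - u x t z ** flow 0 t z"

lemma flow_x_deriv:
  assumes "(x, t) \<in> semistrip a"
  shows "((\<lambda>\<xi>. flow \<xi> t z) has_vector_derivative
    j_mat ** offdiag (Dt a v x t) + dirac (v x t) z ** flow x t z - flow x t z ** dirac (v x t) z)
    (at x within {0..})"
proof -
  note mult = bounded_bilinear.has_vector_derivative[OF bounded_bilinear_matrix_mult]
    and off = bounded_linear.has_vector_derivative[OF bounded_linear_offdiag]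
    and scale = bounded_linear.has_vector_derivative[OF bounded_linear_cscale]
  have v: "((\<lambda>\<xi>. offdiag (v \<xi> t)) has_vector_derivative offdiag (Dx v x t)) (at x within {0..})"
    by (intro off v_x_deriv assms)
  have v': "((\<lambda>\<xi>. offdiag (Dx v \<xi> t)) has_vector_derivative offdiag (Dx (Dx v) x t)) (at x
      within {0..})"
    by (intro off Dx_works[OF v_xx] assms)
  have jv: "((\<lambda>\<xi>. j_mat ** offdiag (v \<xi> t)) has_vector_derivative j_mat ** offdiag (Dx v x t))
      (at x within {0..})"
    using mult[OF has_vector_derivative_const[of j_mat] v]
    by (simp add: bounded_bilinear.zero_left[OF bounded_bilinear_matrix_mult])
  have vv: "((\<lambda>\<xi>. j_mat ** (offdiag (v \<xi> t) ** offdiag (v \<xi> t))) has_vector_derivative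
     j_mat ** (offdiag (Dx v x t) ** offdiag (v x t) + offdiag (v x t) ** offdiag (Dx v x t)))
         (at x within {0..})"
    using mult[OF has_vector_derivative_const[of j_mat] mult[OF v v]]
    by (simp add: bounded_bilinear.zero_left[OF bounded_bilinear_matrix_mult] add.commute)
  have "((\<lambda>\<xi>. flow \<xi> t z) has_vector_derivative
     \<i> \<cdot> (0 - (\<i> * z) \<cdot> (j_mat ** offdiag (Dx v x t)) - (1 / 2) \<cdot> (offdiag (Dx (Dx v) x t)
       + j_mat ** (offdiag (Dx v x t) ** offdiag (v x t) + offdiag (v x t) ** offdiag (Dx v x
           t))))) (at x within {0..})"
    unfolding nls_flow_def
    by (intro scale has_vector_derivative_diff has_vector_derivative_add
        has_vector_derivative_const jv v' vv)
  then have "((\<lambda>\<xi>. flow \<xi> t z) has_vector_derivative nls_flow_x (v x t) (Dx v x t) (Dx (Dx v) x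
      t) z) (at x within {0..})"
    unfolding nls_flow_x_def diff_0 .
  moreover have nls: "2 \<cdot> Dt a v x t + \<i> \<cdot> (Dx (Dx v) x t + 2 \<cdot> (v x t ** ctranspose (v x t) **
      v x t)) = 0"
    using NLS assms unfolding focusing_NLS_def by blast
  ultimately show ?thesis unfolding zero_curvature[OF nls] by blast
qed

text \<open>The candidate solves the Dirac equation differentiated formally in time,
  \<open>y_x = G_t u + G y\<close>; the products \<open>F G u\<close> cancel.\<close>

lemma du_x_deriv:
  assumes "(x, t) \<in> semistrip a"
  shows "((\<lambda>\<xi>. du \<xi> t z) has_vector_derivative
    j_mat ** offdiag (Dt a v x t) ** u x t z + dirac (v x t) z ** du x t z) (at x within {0..})"
proof -
  note bb = bounded_bilinear_matrix_mult
  note mult = bounded_bilinear.has_vector_derivative[OF bb]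
  show ?thesis
    using has_vector_derivative_diff[OF mult[OF flow_x_deriv[OF assms] u_ode[OF assms]]
       mult[OF u_ode[OF assms] has_vector_derivative_const]]
    by (rule has_vector_derivative_eq_rhs)
       (simp add: bounded_bilinear.add_left[OF bb] bounded_bilinear.diff_left[OF bb]
         bounded_bilinear.diff_right[OF bb] bounded_bilinear.zero_right[OF bb] matrix_mul_assoc)
qed

text \<open>No mixed derivatives are interchanged: the remainder of the expansion in time is
  estimated directly, as the solution of an equation in \<open>x\<close> with zero initial value and
  an inhomogeneity that is small compared with the time increment.\<close>

lemma u_t_deriv:
  assumes x: "0 \<le> x" and t: "t \<in> time_interval a"
  shows "((\<lambda>\<tau>. u x \<tau> z) has_vector_derivative du x t z) (at t within time_interval a)"
  unfolding has_vector_derivative_def has_derivative_within_alt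
proof (intro conjI allI impI)
  show "bounded_linear (\<lambda>h. h *\<^sub>R du x t z)" by (rule bounded_linear_scaleR_left)
  fix e :: real assume e: "0 < e"
  note bb = bounded_bilinear_matrix_mult
  have st: "(s, \<tau>) \<in> semistrip a" if "s \<in> {0..x}" "\<tau> \<in> time_interval a" for s \<tau>
    using that by (intro semistripI) auto
  have continuous: "continuous_on {0..x} f"
    if "\<And>s. s \<in> {0..x} \<Longrightarrow> (f has_vector_derivative f' s) (at s within {0..})"
    for f f' :: "real \<Rightarrow> complex^('m1 + 'm2)^('m1 + 'm2)"
    unfolding continuous_on_eq_continuous_within
    by (intro ballI continuous_within_subset[OF has_vector_derivative_continuous[OF that]]) auto
  have bounded: "\<exists>B>0. \<forall>s\<in>{0..x}. norm (f s) \<le> B"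
    if "continuous_on {0..x} f" for f :: "real \<Rightarrow> complex^('m1 + 'm2)^('m1 + 'm2)"
    using compact_imp_bounded[OF compact_continuous_image[OF that compact_Icc]]
    unfolding bounded_pos by auto
  obtain Bu where Bu: "0 < Bu" "\<And>s. s \<in> {0..x} \<Longrightarrow> norm (u s t z) \<le> Bu"
  proof -
    have "continuous_on {0..x} (\<lambda>s. u s t z)"
      by (rule continuous, rule u_ode, rule st[OF _ t])
    from bounded[OF this] that show thesis by fast
  qed
  obtain Bs where Bs: "0 < Bs" "\<And>s. s \<in> {0..x} \<Longrightarrow> norm (du s t z) \<le> Bs"
  proof -
    have "continuous_on {0..x} (\<lambda>s. du s t z)"
      by (rule continuous, rule du_x_deriv, rule st[OF _ t])
    from bounded[OF this] that show thesis by fast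
  qed
  have "continuous_on {0..x} (\<lambda>s. v s t)"
    unfolding continuous_on_eq_continuous_within
    by (intro ballI continuous_within_subset[OF has_vector_derivative_continuous[OF v_x_deriv[OF
        st[OF _ t]]]]) auto
  then have "continuous_on {0..x} (\<lambda>s. dirac (v s t) z)" by (rule continuous_on_dirac)
  from bounded[OF this]
  obtain Bg where Bg: "0 < Bg" "\<And>s. s \<in> {0..x} \<Longrightarrow> norm (dirac (v s t) z) \<le> Bg"
    by fast
  obtain Bv where Bv: "0 < Bv" "\<And>s. s \<in> {0..x} \<Longrightarrow> norm (Dt a v s t) \<le> Bv"
  proof -
    have "continuous_on (semistrip a) (\<lambda>(x, t). Dt a v x t)"
      using v_C1 by (simp only: continuously_differentiable_def)
    moreover have "continuous_on {0..x} (\<lambda>s. (s, t))"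
      by (intro continuous_intros)
    moreover have "(\<lambda>s. (s, t)) ` {0..x} \<subseteq> semistrip a"
      using t by (auto simp: semistrip_def)
    ultimately have "continuous_on {0..x} (\<lambda>s. (\<lambda>(x, t). Dt a v x t) (s, t))"
      by (rule continuous_on_compose2)
    from compact_imp_bounded[OF compact_continuous_image[OF this compact_Icc]]
    obtain B where "0 < B" "\<forall>y \<in> (\<lambda>s. (\<lambda>(x, t). Dt a v x t) (s, t)) ` {0..x}. norm y \<le> B"
      unfolding bounded_pos by blast
    then show thesis by (intro that[of B]) simp_all
  qed
  obtain K where K: "0 < K" "\<And>(A :: complex^('m1 + 'm2)^('m1 + 'm2)) (B :: complex^('m1 +
      'm2)^('m1 + 'm2)).
      norm (A ** B) \<le> norm A * norm B * K"
    using bounded_bilinear.pos_bounded[OF bb] by blast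
  have blin: "bounded_linear (\<lambda>q :: complex^'m2^'m1. j_mat ** offdiag q)"
    by (intro bounded_linear_compose[OF bounded_bilinear.bounded_linear_right[OF bb]
        bounded_linear_offdiag])
  then obtain C where C: "0 < C" "\<And>q :: complex^'m2^'m1. norm (j_mat ** offdiag q) \<le> norm q * C"
    using bounded_linear.pos_bounded by blast
  \<comment> \<open>\<open>\<alpha>\<close> bounds left multiplication by \<open>G\<close> at the
    shifted time for increments of size at most 1. \<open>Q\<close> is the Gronwall bound with the
    factor \<open>|h| \<epsilon>\<close> split off, so \<open>\<epsilon> Q \<le> e\<close>
    suffices.\<close>
  define \<alpha> where "\<alpha> = (Bg + (1 + Bv) * C) * K"
  define Q where "Q = (C * Bu * K + (1 + Bv) * C * Bs * K) * exp ((\<alpha> + 1) * (x - 0))"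
  have Q: "0 < Q" and \<alpha>: "0 \<le> \<alpha>"
    using K C Bu Bs Bv Bg by (auto simp: Q_def \<alpha>_def intro!: mult_pos_pos add_pos_pos)
  define \<epsilon> where "\<epsilon> = min 1 (e / Q)"
  have \<epsilon>: "0 < \<epsilon>" "\<epsilon> \<le> 1" using e Q by (simp_all add: \<epsilon>_def)
  have "\<epsilon> * Q \<le> (e / Q) * Q" using Q by (intro mult_right_mono) (simp_all add: \<epsilon>_def)
  then have \<epsilon>Q: "\<epsilon> * Q \<le> e" using Q by simp
  obtain \<delta> where \<delta>: "0 < \<delta>"
    "\<And>s \<tau>. \<lbrakk>s \<in> {0..x}; \<tau> \<in> time_interval a; \<bar>\<tau> - t\<bar> < \<delta>\<rbrakk> \<Longrightarrow>
      norm (v s \<tau> - v s t - (\<tau> - t) *\<^sub>R Dt a v s t) \<le> \<bar>\<tau> - t\<bar> * \<epsilon>"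
    using uniform_time_increment[OF v_C1 t \<epsilon>(1), of x] by blast
  \<comment> \<open>\<open>\<delta>\<close> controls the remainder in the expansion of
    \<open>v\<close>, while \<open>|h| < \<epsilon>\<close> controls the product of two first-order
    increments.\<close>
  have "norm (u x \<tau> z - u x t z - (\<tau> - t) *\<^sub>R du x t z) \<le> e * norm (\<tau> - t)"
    if \<tau>: "\<tau> \<in> time_interval a" "norm (\<tau> - t) < min \<delta> \<epsilon>" for \<tau>
  proof -
    let ?h = "\<tau> - t"
    let ?D = "\<lambda>s. u s \<tau> z - u s t z - ?h *\<^sub>R du s t z"
    define D' where "D' s = dirac (v s \<tau>) z ** u s \<tau> z - dirac (v s t) z ** u s t z
      - ?h *\<^sub>R (j_mat ** offdiag (Dt a v s t) ** u s t z + dirac (v s t) z ** du s t z)" for s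
    have "norm (?D x) \<le> (\<bar>?h\<bar> * \<epsilon> * (C * Bu * K + (1 + Bv) * C * Bs * K)) * exp ((\<alpha> + 1) * (x - 0))"
    proof (rule norm_le_gronwall[where w = ?D and w' = D' and S = "{0..}"])
      fix s assume s: "s \<in> {0..x}"
      show "(?D has_vector_derivative D' s) (at s within {0..})"
        unfolding D'_def
        by (rule has_vector_derivative_diff[OF has_vector_derivative_diff[OF u_ode[OF st[OF s
            \<tau>(1)]] u_ode[OF st[OF s t]]] bounded_linear.has_vector_derivative[OF
                bounded_linear_scaleR_right du_x_deriv[OF st[OF s t]]]])
      define q where "q = v s \<tau> - v s t"
      define r where "r = q - ?h *\<^sub>R Dt a v s t"
      have r: "norm r \<le> \<bar>?h\<bar> * \<epsilon>"
        unfolding r_def q_def using \<delta>(2)[OF s \<tau>(1)] \<tau>(2) by simp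
      have "norm q \<le> norm r + norm (?h *\<^sub>R Dt a v s t)"
        using norm_triangle_ineq[of r "?h *\<^sub>R Dt a v s t"] unfolding r_def diff_add_cancel .
      also have "\<dots> \<le> \<bar>?h\<bar> * 1 + \<bar>?h\<bar> * Bv"
        unfolding norm_scaleR
        by (intro add_mono order.trans[OF r] mult_left_mono Bv(2) s \<epsilon>(2)) simp_all
      finally have q: "norm q \<le> \<bar>?h\<bar> * (1 + Bv)" by (simp add: algebra_simps)
      have Gq: "dirac (v s \<tau>) z = dirac (v s t) z + j_mat ** offdiag q"
        unfolding dirac_def q_def by (simp add: linear_diff[OF bounded_linear.linear[OF blin]])
      have Gr: "j_mat ** offdiag q = j_mat ** offdiag r + ?h *\<^sub>R (j_mat ** offdiag (Dt a v s t))"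
        unfolding r_def
        by (simp add: linear_diff[OF bounded_linear.linear[OF blin]] linear_scale[OF
            bounded_linear.linear[OF blin]])
      have "D' s = dirac (v s \<tau>) z ** ?D s + (j_mat ** offdiag r) ** u s t z + ?h *\<^sub>R ((j_mat **
          offdiag q) ** du s t z)"
        unfolding D'_def by (rule difference_derivative_identity[OF Gq Gr])
      then have D'_le: "norm (D' s) \<le> norm (dirac (v s \<tau>) z ** ?D s) + norm (j_mat ** offdiag r
          ** u s t z)
          + norm (?h *\<^sub>R (j_mat ** offdiag q ** du s t z))"
        by (simp only:) (rule order.trans[OF norm_triangle_ineq add_right_mono[OF
            norm_triangle_ineq]])
      have le1: "norm (dirac (v s \<tau>) z ** ?D s) \<le> \<alpha> * norm (?D s)"
      proof -
        have "norm (dirac (v s \<tau>) z) \<le> Bg + norm q * C"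
          unfolding Gq by (intro order.trans[OF norm_triangle_ineq] add_mono Bg(2) s C(2))
        also have "norm q * C \<le> (1 + Bv) * C"
        proof (intro mult_right_mono)
          have "\<bar>?h\<bar> * (1 + Bv) \<le> 1 * (1 + Bv)" using \<tau>(2) \<epsilon>(2) Bv(1) by (intro mult_right_mono)
              auto
          with q show "norm q \<le> 1 + Bv" by simp
        qed (use C in simp)
        finally have "norm (dirac (v s \<tau>) z) * norm (?D s) * K \<le> (Bg + (1 + Bv) * C) * norm (?D
            s) * K"
          using K(1) by (intro mult_right_mono) auto
        with K(2)[of "dirac (v s \<tau>) z" "?D s"]
        show ?thesis by (simp only: \<alpha>_def mult_ac)
      qed
      have le2: "norm (j_mat ** offdiag r ** u s t z) \<le> \<bar>?h\<bar> * \<epsilon> * (C * Bu * K)"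
      proof -
        have "norm (j_mat ** offdiag r ** u s t z) \<le> norm (j_mat ** offdiag r) * norm (u s t z)
            * K" by (rule K(2))
        also have "\<dots> \<le> (\<bar>?h\<bar> * \<epsilon> * C) * Bu * K"
          using C K Bu s r \<epsilon>(1) by (intro mult_right_mono mult_mono order.trans[OF C(2)]) auto
        finally show ?thesis by (simp only: mult_ac)
      qed
      have le3: "norm (?h *\<^sub>R (j_mat ** offdiag q ** du s t z)) \<le> \<bar>?h\<bar> * \<epsilon> * ((1 + Bv) * C * Bs
          * K)"
      proof -
        have "norm (j_mat ** offdiag q ** du s t z) \<le> norm (j_mat ** offdiag q) * norm (du s t
            z) * K" by (rule K(2))
        also have "\<dots> \<le> (\<bar>?h\<bar> * (1 + Bv) * C) * Bs * K"
          using C K Bs s q Bv(1) by (intro mult_right_mono mult_mono order.trans[OF C(2)]) auto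
        also have "\<dots> \<le> (\<epsilon> * (1 + Bv) * C) * Bs * K"
          using \<tau>(2) C K Bs Bv(1) by (intro mult_right_mono) auto
        finally have "\<bar>?h\<bar> * norm (j_mat ** offdiag q ** du s t z) \<le> \<bar>?h\<bar> * ((\<epsilon> * (1 + Bv) * C)
            * Bs * K)"
          by (rule mult_left_mono) simp
        then show ?thesis by (simp only: norm_scaleR real_norm_def mult_ac)
      qed
      show "norm (D' s) \<le> \<alpha> * norm (?D s) + \<bar>?h\<bar> * \<epsilon> * (C * Bu * K + (1 + Bv) * C * Bs * K)"
        using D'_le le1 le2 le3 by (simp only: distrib_left)
    next
      show "?D 0 = 0" using u_init t \<tau>(1) by simp
      show "0 \<le> \<bar>?h\<bar> * \<epsilon> * (C * Bu * K + (1 + Bv) * C * Bs * K)"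
        using C K Bu Bs Bv \<epsilon> by (intro mult_nonneg_nonneg add_nonneg_nonneg) auto
    qed (use x \<alpha> in auto)
    also have "\<dots> = (\<epsilon> * Q) * \<bar>?h\<bar>" by (simp add: Q_def)
    also have "\<dots> \<le> e * \<bar>?h\<bar>" using \<epsilon>Q by (rule mult_right_mono) simp
    finally show ?thesis by simp
  qed
  then show "\<exists>d>0. \<forall>y\<in>time_interval a. norm (y - t) < d \<longrightarrow>
      norm (u x y z - u x t z - (y - t) *\<^sub>R du x t z) \<le> e * norm (y - t)"
    using \<delta>(1) \<epsilon>(1) by (intro exI[of _ "min \<delta> \<epsilon>"]) auto
qed

end

section \<open>Evolution of the Weyl function\<close>

context nls_solution
begin

text \<open>For \<open>Y = u R\<close> the term \<open>- u F(0,t,z)\<close> of \<open>u_t\<close>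
  cancels against \<open>R_t\<close>, leaving \<open>Y_t = F Y\<close>. The bound on
  \<open>Re (w* F w)\<close> is independent of \<open>x\<close>, and Gronwall is used in both
  directions.\<close>

lemma propagator_norm_bounds:
  assumes x: "0 \<le> x" and t: "t \<in> time_interval a"
    and R_ode: "\<And>\<tau>. \<tau> \<in> time_interval a \<Longrightarrow>
      (R has_vector_derivative flow 0 \<tau> z ** R \<tau>) (at \<tau> within time_interval a)"
  defines "K \<equiv> 2 * ((cmod z)\<^sup>2 + cmod z * M)"
  shows "(norm (u x t z *v (R t *v c)))\<^sup>2 \<le> (norm (u x 0 z *v (R 0 *v c)))\<^sup>2 * exp (K * t)"
    and "(norm (u x 0 z *v (R 0 *v c)))\<^sup>2 * exp (- K * t) \<le> (norm (u x t z *v (R t *v c)))\<^sup>2"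
proof -
  note bb = bounded_bilinear_matrix_mult
  let ?w = "\<lambda>\<tau>. (u x \<tau> z ** R \<tau>) *v c"
  have t0: "0 \<le> t" and sub: "{0..t} \<subseteq> time_interval a"
    using t by (auto simp: time_interval_def intro: le_less_trans[of "ereal _" "ereal t"])
  have deriv: "((\<lambda>\<tau>. (norm (?w \<tau>))\<^sup>2) has_real_derivative 2 * (?w \<tau> \<bullet> (flow x \<tau> z *v ?w \<tau>))) (at
      \<tau> within time_interval a)"
    if "\<tau> \<in> {0..t}" for \<tau>
  proof -
    have \<tau>: "\<tau> \<in> time_interval a" using that sub by blast
    have "((\<lambda>\<tau>. u x \<tau> z ** R \<tau>) has_vector_derivative
        u x \<tau> z ** (flow 0 \<tau> z ** R \<tau>) + (flow x \<tau> z ** u x \<tau> z - u x \<tau> z ** flow 0 \<tau> z) ** R \<tau>)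
            (at \<tau> within time_interval a)"
      by (rule bounded_bilinear.has_vector_derivative[OF bb u_t_deriv[OF x \<tau>] R_ode[OF \<tau>]])
    moreover have "u x \<tau> z ** (flow 0 \<tau> z ** R \<tau>) + (flow x \<tau> z ** u x \<tau> z - u x \<tau> z ** flow 0 \<tau>
        z) ** R \<tau>
        = flow x \<tau> z ** (u x \<tau> z ** R \<tau>)"
      by (simp add: bounded_bilinear.diff_left[OF bb] matrix_mul_assoc)
    ultimately have "((\<lambda>\<tau>. u x \<tau> z ** R \<tau>) has_vector_derivative flow x \<tau> z ** (u x \<tau> z ** R \<tau>))
        (at \<tau> within time_interval a)"
      by simp
    from bounded_linear.has_vector_derivative[OF bounded_bilinear.bounded_linear_left[OF
      bounded_bilinear_matrix_vector_mult] this, of c]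
    have "(?w has_vector_derivative flow x \<tau> z *v ?w \<tau>) (at \<tau> within time_interval a)"
      by (simp only: matrix_vector_mul_assoc)
    then show ?thesis by (rule has_real_derivative_norm_square)
  qed
  have bound: "\<bar>2 * (?w \<tau> \<bullet> (flow x \<tau> z *v ?w \<tau>))\<bar> \<le> K * (norm (?w \<tau>))\<^sup>2" if "\<tau> \<in> {0..t}" for \<tau>
    using mult_left_mono[OF inner_nls_flow_le[OF v_bound[OF semistripI[OF x subsetD[OF sub that]]],
      of "?w \<tau>" "Dx v x \<tau>" z], of 2]
    by (simp only: K_def abs_mult abs_numeral mult.assoc)
  have "(norm (?w t))\<^sup>2 \<le> (norm (?w 0))\<^sup>2 * exp (K * (t - 0))"
    by (rule gronwall[OF deriv sub t0]) (use abs_le_D1[OF bound] in auto)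
  then show "(norm (u x t z *v (R t *v c)))\<^sup>2 \<le> (norm (u x 0 z *v (R 0 *v c)))\<^sup>2 * exp (K * t)"
    by (simp add: matrix_vector_mul_assoc)
  have "- (norm (?w t))\<^sup>2 \<le> - (norm (?w 0))\<^sup>2 * exp (- K * (t - 0))"
    by (rule gronwall[OF DERIV_minus[OF deriv] sub t0]) (use abs_le_D2[OF bound] in auto)
  then show "(norm (u x 0 z *v (R 0 *v c)))\<^sup>2 * exp (- K * t) \<le> (norm (u x t z *v (R t *v c)))\<^sup>2"
    by (simp add: matrix_vector_mul_assoc)
qed

lemma propagated_weyl_solution:
  assumes t: "t \<in> time_interval a" and z: "M < Im z"
    and R_ode: "\<And>\<tau>. \<tau> \<in> time_interval a \<Longrightarrow>
      (R has_vector_derivative flow 0 \<tau> z ** R \<tau>) (at \<tau> within time_interval a)"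
    and R_init: "R 0 = mat 1"
    and nonneg: "\<And>x. 0 \<le> x \<Longrightarrow> 0 \<le> jform (u x 0 z *v w)"
    and x: "0 \<le> x"
  shows "0 \<le> jform (u x t z *v (R t *v w))"
proof (rule ccontr)
  define \<eta> where "\<eta> = - jform (u x t z *v (R t *v w))"
  assume "\<not> ?thesis"
  then have \<eta>: "0 < \<eta>" by (simp add: \<eta>_def)
  have t0: "0 \<in> time_interval a"
    using t by (auto simp: time_interval_def zero_ereal_def intro: le_less_trans[of _ "ereal t"])
  interpret t: dirac_system "\<lambda>x. v x t" M "\<lambda>x z. u x t z" by (rule dirac_system_at[OF t])
  interpret t0: dirac_system "\<lambda>x. v x 0" M "\<lambda>x z. u x 0 z" by (rule dirac_system_at[OF t0])
  define C where "C = exp (2 * ((cmod z)\<^sup>2 + cmod z * M) * t)"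
  have C: "0 < C" by (simp add: C_def)
  \<comment> \<open>Once the form equals \<open>- \<eta>\<close>, monotonicity keeps it there or
    below, so the solution at time \<open>t\<close> has squared norm at least \<open>\<eta>\<close>.
    Passing to time \<open>0\<close> costs the factor \<open>C\<close>.\<close>
  have lower: "\<eta> / C \<le> (norm (u y 0 z *v w))\<^sup>2" if y: "x \<le> y" for y
  proof -
    have "\<eta> \<le> - jform (u y t z *v (R t *v w))"
      unfolding \<eta>_def using t.jform_decreasing[OF z x y] by simp
    also have "\<dots> \<le> (norm (u y t z *v (R t *v w)))\<^sup>2" by (rule jform_le_norm)
    also have "\<dots> \<le> (norm (u y 0 z *v w))\<^sup>2 * C"
      using propagator_norm_bounds(1)[OF order.trans[OF x y] t R_ode] by (simp add: R_init C_def)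
    finally show ?thesis using C by (simp add: divide_le_eq)
  qed
  define k where "k = 2 * (Im z - M) * (\<eta> / C)"
  have k: "0 < k" unfolding k_def using z \<eta> C by (intro mult_pos_pos divide_pos_pos) auto
  \<comment> \<open>Decreasing at rate at least \<open>k\<close> from \<open>x\<close> on, the form
    at time \<open>0\<close> would be at most \<open>-1\<close> here.\<close>
  define y where "y = x + (jform (u x 0 z *v w) + 1) / k"
  have xy: "x \<le> y" unfolding y_def using nonneg[OF x] k by simp
  have "jform (u y 0 z *v w) \<le> jform (u x 0 z *v w) + (- 2 * (Im z - M) * (\<eta> / C)) * (y - x)"
    by (rule t0.jform_decay[OF z x xy]) (use lower in auto)
  also have "\<dots> = jform (u x 0 z *v w) - k * (y - x)" by (simp add: k_def algebra_simps)
  also have "k * (y - x) = jform (u x 0 z *v w) + 1" unfolding y_def using k by simp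
  finally show False using nonneg[OF order.trans[OF x xy]] by simp
qed

end

text \<open>The blocks of \<open>A [I; \<phi>]\<close> are the denominator and the numerator of the
  linear fractional transformation given by \<open>A\<close>.\<close>

lemma row_I0_mult_stack: "row_I0 ** (A ** stack \<phi>) = block11 A + block12 A ** \<phi>"
  and row_0I_mult_stack: "row_0I ** (A ** stack \<phi>) = block21 A + block22 A ** \<phi>"
proof -
  have "(A ** stack \<phi>) $ i $ k = A $ i $ Inl k + (\<Sum>r\<in>UNIV. A $ i $ Inr r * \<phi> $ r $ k)" for i k
    unfolding matrix_matrix_mult_def[of A]
    by (simp add: UNIV_sum_split stack_def mat_def if_distrib[of "\<lambda>x. _ * x"] cong: if_cong)
  then show "row_I0 ** (A ** stack \<phi>) = block11 A + block12 A ** \<phi>"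
    and "row_0I ** (A ** stack \<phi>) = block21 A + block22 A ** \<phi>"
    by (simp_all add: vec_eq_iff block11_def block12_def block21_def block22_def)
       (simp_all add: matrix_matrix_mult_def)
qed

theorem theorem4p3:
  fixes v :: "real \<Rightarrow> real \<Rightarrow> complex^'m2^'m1"
    and a :: ereal and M :: real
    and u R :: "real \<Rightarrow> real \<Rightarrow> complex \<Rightarrow> complex^('m1 + 'm2)^('m1 + 'm2)"
    and \<phi> :: "real \<Rightarrow> complex \<Rightarrow> complex^'m1^'m2"
  assumes M_pos: "0 < M"
    and v_C1: "continuously_differentiable a v"
    and v_x_C1: "continuously_differentiable a (Dx v)"
    and v_t_C1: "continuously_differentiable a (Dt a v)"
    and v_xx: "x_differentiable a (Dx v)"
    and NLS: "focusing_NLS a v"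
    and v_bound: "\<And>x t. (x, t) \<in> semistrip a \<Longrightarrow> opnorm (v x t) \<le> M"
    and v_x_bound: "\<And>t. t \<in> time_interval a \<Longrightarrow> bdd_above ((\<lambda>x. opnorm (Dx v x t)) ` {0..})"
    and u_ode: "\<And>x t z. (x, t) \<in> semistrip a \<Longrightarrow>
      ((\<lambda>\<xi>. u \<xi> t z) has_vector_derivative G_mat v x t z ** u x t z) (at x within {0..})"
    and u_init: "\<And>t z. t \<in> time_interval a \<Longrightarrow> u 0 t z = mat 1"
    and R_ode: "\<And>x t z. (x, t) \<in> semistrip a \<Longrightarrow>
      ((\<lambda>\<tau>. R x \<tau> z) has_vector_derivative F_mat v x t z ** R x t z) (at t within time_interval a)"
    and R_init: "\<And>x z. 0 \<le> x \<Longrightarrow> R x 0 z = mat 1"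
    and weyl: "\<And>t. t \<in> time_interval a \<Longrightarrow> is_weyl_function M (\<lambda>x z. u x t z) (\<phi> t)"
  shows "\<forall>t \<in> time_interval a. \<forall>z. M < Im z \<longrightarrow>
    invertible (block11 (R 0 t z) + block12 (R 0 t z) ** \<phi> 0 z) \<and>
    \<phi> t z =
      (block21 (R 0 t z) + block22 (R 0 t z) ** \<phi> 0 z)
        ** matrix_inv (block11 (R 0 t z) + block12 (R 0 t z) ** \<phi> 0 z)"
proof (intro ballI allI impI)
  fix t z assume t: "t \<in> time_interval a" and z: "M < Im z"
  have t0: "0 \<in> time_interval a"
    using t by (auto simp: time_interval_def zero_ereal_def intro: le_less_trans[of _ "ereal t"])
  interpret nls_solution v a M u
    using u_ode by unfold_locales (auto intro: v_C1 v_xx NLS v_bound u_init simp: G_mat_dirac)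
  \<comment> \<open>Used in both directions: at time \<open>0\<close> it supplies nonnegativity, at
    time \<open>t\<close> it identifies the quotient.\<close>
  have weyl_at: "(\<forall>x\<ge>0. \<psi> \<in> dirac_system.admissible (\<lambda>x z. u x s z) x z) \<longleftrightarrow> \<psi> = \<phi> s z"
    if "s \<in> time_interval a" for s \<psi>
    using dirac_system.weyl_function_characterization[OF dirac_system_at[OF that] z] weyl[OF that] z
    by (simp add: is_weyl_function_def half_plane_def)
  have R_flow: "((\<lambda>\<tau>. R 0 \<tau> z) has_vector_derivative flow 0 \<tau> z ** R 0 \<tau> z) (at \<tau> within
      time_interval a)"
    if "\<tau> \<in> time_interval a" for \<tau>
  proof -
    have st: "(0, \<tau>) \<in> semistrip a" using that by (intro semistripI) simp_all
    have "F_mat v 0 \<tau> z = flow 0 \<tau> z"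
      by (rule F_mat_nls_flow[OF _ st]) (use v_C1 in \<open>simp add: continuously_differentiable_def\<close>)
    then show ?thesis using R_ode[OF st, of z] by simp
  qed
  define W where "W = R 0 t z ** stack (\<phi> 0 z)"
  have Wv: "W *v c = R 0 t z *v (stack (\<phi> 0 z) *v c)" for c
    by (simp add: W_def matrix_vector_mul_assoc)
  have nonneg0: "0 \<le> jform (u x 0 z *v (stack (\<phi> 0 z) *v c))" if "0 \<le> x" for x c
    using weyl_at[OF t0, of "\<phi> 0 z"] that dirac_system.admissible_def[OF dirac_system_at[OF t0]]
        by auto
  have nonneg: "0 \<le> jform (u x t z *v (W *v c))" if "0 \<le> x" for x c
    unfolding Wv
    by (rule propagated_weyl_solution[OF t z R_flow]) (use that R_init nonneg0 in auto)
  \<comment> \<open>At \<open>x = 0\<close> the factor \<open>u\<close> is the identity, so the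
    lower norm bound shows that \<open>R 0 t z\<close> has trivial kernel.\<close>
  have inj: "c = 0" if "W *v c = 0" for c
  proof -
    have "norm (stack (\<phi> 0 z) *v c) = 0"
      using propagator_norm_bounds(2)[OF order.refl t R_flow, of "stack (\<phi> 0 z) *v c"] that
      by (simp add: Wv u_init t t0 R_init mult_le_0_iff)
    then show ?thesis by (simp add: stack_injective)
  qed
  have nonnegW: "0 \<le> jform (W *v c)" for c
    using nonneg[of 0 c] by (simp add: u_init t)
  have "invertible (row_I0 ** W)"
    by (rule invertible_upper_block[OF inj nonnegW])
  \<comment> \<open>The quotient is admissible for every \<open>x\<close> at time \<open>t\<close>,
    which only the Weyl function is.\<close>
  moreover have "row_0I ** W ** matrix_inv (row_I0 ** W) = \<phi> t z"
    unfolding weyl_at[OF t, symmetric]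
    by (intro allI impI dirac_system.quotient_admissible[OF dirac_system_at[OF t] inj nonnegW
        nonneg])
  ultimately show "invertible (block11 (R 0 t z) + block12 (R 0 t z) ** \<phi> 0 z) \<and> \<phi> t z =
      (block21 (R 0 t z) + block22 (R 0 t z) ** \<phi> 0 z)
        ** matrix_inv (block11 (R 0 t z) + block12 (R 0 t z) ** \<phi> 0 z)"
    unfolding W_def row_I0_mult_stack row_0I_mult_stack by simp
qed

end
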